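(* Let $(R,\mathfrak m)$ be a Buchsbaum local ring of dimension $d>1$, and let $M$ be a nonzero finitely generated $R$-module with $\operatorname{p.dim}_R(M)=\infty$ and $\lambda(M)<\infty$. Then $\operatorname{Supp}(\operatorname{Syz}_i(M))=\operatorname{Spec}(R)$ for all $i>0$. In particular, $\lambda(\operatorname{Syz}_i(M))=\infty$ for all $i>0$.
   Context: Rings are commutative and noetherian. $\operatorname{p.dim}$ denotes projective dimension and $\lambda(-)$ denotes length. For a finitely generated module $M$ over a local ring $(R,\mathfrak m,k)$, let $\cdots\to R^{\beta_{i+1}}\xrightarrow{f_{i+1}}R^{\beta_i}\xrightarrow{f_i}\cdots\to R^{\beta_0}\xrightarrow{f_0}M\to 0$ be the minimal free resolution. For $i>0$, $\operatorname{Syz}_i(M):=\operatorname{coker}(f_{i+1})=\ker(f_{i-1})$ is the $i$-th syzygy module. A sequence $x_1,\dots,x_r$ in $\mathfrak m$ is a weak sequence if $\mathfrak m\,((x_1,\dots,x_{i-1}):x_i)\subseteq(x_1,\dots,x_{i-1})$ for all $i$. The local ring $R$ is called Buchsbaum if every system of parameters of $R$ is a weak sequence. *)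

theory Defs
  imports "HOL-Algebra.Algebra" "HOL-Library.Extended_Nat"
begin

section \<open>Rings\<close>

locale noetherian_local_ring = cring R + noetherian_ring R + maximalideal m R
  for R (structure) and m +
  assumes unique_maximal: "maximalideal J R \<Longrightarrow> J = m"

definition Spec :: "('a, 'r) ring_scheme \<Rightarrow> 'a set set" where
  "Spec R = {P. primeideal P R}"

definition krull_dim :: "('a, 'r) ring_scheme \<Rightarrow> enat" where
  "krull_dim R = Sup {enat n | n. \<exists>p. (\<forall>i\<le>n. p i \<in> Spec R) \<and> (\<forall>i<n. p i \<subset> p (Suc i))}"

definition ideal_radical :: "('a, 'r) ring_scheme \<Rightarrow> 'a set \<Rightarrow> 'a set" where
  "ideal_radical R I = {r \<in> carrier R. \<exists>n::nat. r [^]\<^bsub>R\<^esub> n \<in> I}"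

definition ideal_colon :: "('a, 'r) ring_scheme \<Rightarrow> 'a set \<Rightarrow> 'a \<Rightarrow> 'a set" where
  "ideal_colon R I x = {r \<in> carrier R. r \<otimes>\<^bsub>R\<^esub> x \<in> I}"

definition system_of_parameters :: "('a, 'r) ring_scheme \<Rightarrow> 'a set \<Rightarrow> 'a list \<Rightarrow> bool" where
  "system_of_parameters R m xs \<longleftrightarrow>
     set xs \<subseteq> m \<and> enat (length xs) = krull_dim R \<and> ideal_radical R (Idl\<^bsub>R\<^esub> (set xs)) = m"

text \<open>Lists are indexed from 0, so the ideal generated by the entries preceding
  \<open>xs ! i\<close> is \<open>Idl (set (take i xs))\<close>, which is the zero ideal for \<open>i = 0\<close>.\<close>

definition weak_sequence :: "('a, 'r) ring_scheme \<Rightarrow> 'a set \<Rightarrow> 'a list \<Rightarrow> bool" where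
  "weak_sequence R m xs \<longleftrightarrow> set xs \<subseteq> m \<and>
     (\<forall>i<length xs. m \<cdot>\<^bsub>R\<^esub> ideal_colon R (Idl\<^bsub>R\<^esub> (set (take i xs))) (xs ! i)
                      \<subseteq> Idl\<^bsub>R\<^esub> (set (take i xs)))"

locale buchsbaum_local_ring = noetherian_local_ring +
  assumes sop_weak_sequence: "system_of_parameters R m xs \<Longrightarrow> weak_sequence R m xs"


section \<open>Modules\<close>

definition lin_hom ::
    "('a, 'r) ring_scheme \<Rightarrow> ('a, 'm, 'c) module_scheme \<Rightarrow> ('a, 'n, 'd) module_scheme \<Rightarrow> ('m \<Rightarrow> 'n) set"
  where
  "lin_hom R M N = {h \<in> carrier M \<rightarrow> carrier N.
     (\<forall>x\<in>carrier M. \<forall>y\<in>carrier M. h (x \<oplus>\<^bsub>M\<^esub> y) = h x \<oplus>\<^bsub>N\<^esub> h y) \<and>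
     (\<forall>a\<in>carrier R. \<forall>x\<in>carrier M. h (a \<odot>\<^bsub>M\<^esub> x) = a \<odot>\<^bsub>N\<^esub> h x)}"

definition lin_ker :: "('a, 'm, 'c) module_scheme \<Rightarrow> ('a, 'n, 'd) module_scheme \<Rightarrow> ('m \<Rightarrow> 'n) \<Rightarrow> 'm set"
  where "lin_ker M N h = {x \<in> carrier M. h x = \<zero>\<^bsub>N\<^esub>}"

definition submodule_span :: "('a, 'r) ring_scheme \<Rightarrow> ('a, 'm, 'c) module_scheme \<Rightarrow> 'm set \<Rightarrow> 'm set" where
  "submodule_span R M A = \<Inter>{N. submodule N R M \<and> A \<subseteq> N}"

definition finitely_generated_module :: "('a, 'r) ring_scheme \<Rightarrow> ('a, 'm, 'c) module_scheme \<Rightarrow> bool" where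
  "finitely_generated_module R M \<longleftrightarrow>
     module R M \<and> (\<exists>A\<subseteq>carrier M. finite A \<and> submodule_span R M A = carrier M)"

definition ideal_smult :: "('a, 'r) ring_scheme \<Rightarrow> 'a set \<Rightarrow> ('a, 'm, 'c) module_scheme \<Rightarrow> 'm set" where
  "ideal_smult R I M = submodule_span R M {a \<odot>\<^bsub>M\<^esub> x | a x. a \<in> I \<and> x \<in> carrier M}"

definition module_length :: "('a, 'r) ring_scheme \<Rightarrow> ('a, 'm, 'c) module_scheme \<Rightarrow> enat" where
  "module_length R M =
     Sup {enat n | n. \<exists>N. (\<forall>i\<le>n. submodule (N i) R M) \<and> (\<forall>i<n. N i \<subset> N (Suc i))}"

text \<open>Fractions \<open>x / s\<close> with numerator in \<open>M\<close> and denominator outside \<open>P\<close> are represented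
  by pairs \<open>(x, s)\<close>; the localization \<open>M\<^sub>P\<close> is the set of their classes.\<close>

definition fraction_rel ::
    "('a, 'r) ring_scheme \<Rightarrow> ('a, 'm, 'c) module_scheme \<Rightarrow> 'a set \<Rightarrow> (('m \<times> 'a) \<times> ('m \<times> 'a)) set" where
  "fraction_rel R M P = {((x, s), (y, t)).
     x \<in> carrier M \<and> s \<in> carrier R - P \<and> y \<in> carrier M \<and> t \<in> carrier R - P \<and>
     (\<exists>u\<in>carrier R - P. u \<odot>\<^bsub>M\<^esub> (t \<odot>\<^bsub>M\<^esub> x) = u \<odot>\<^bsub>M\<^esub> (s \<odot>\<^bsub>M\<^esub> y))}"

definition localization ::
    "('a, 'r) ring_scheme \<Rightarrow> ('a, 'm, 'c) module_scheme \<Rightarrow> 'a set \<Rightarrow> ('m \<times> 'a) set set" where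
  "localization R M P = (carrier M \<times> (carrier R - P)) // fraction_rel R M P"

definition Supp :: "('a, 'r) ring_scheme \<Rightarrow> ('a, 'm, 'c) module_scheme \<Rightarrow> 'a set set" where
  "Supp R M = {P \<in> Spec R. localization R M P \<noteq> {fraction_rel R M P `` {(\<zero>\<^bsub>M\<^esub>, \<one>\<^bsub>R\<^esub>)}}}"


section \<open>Resolutions\<close>

text \<open>The free module \<open>R\<^bsup>(S)\<^esup>\<close> on an index set \<open>S\<close>: finitely supported functions, extended by
  zero outside \<open>S\<close>. The fields \<open>mult\<close> and \<open>one\<close>, which records of modules inherit from
  records of rings, carry no meaning for modules.\<close>

definition free_module :: "('a, 'r) ring_scheme \<Rightarrow> 'i set \<Rightarrow> ('a, 'i \<Rightarrow> 'a) module" where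
  "free_module R S =
     \<lparr>carrier = {v. (\<forall>i. v i \<in> carrier R) \<and> (\<forall>i. i \<notin> S \<longrightarrow> v i = \<zero>\<^bsub>R\<^esub>) \<and> finite {i. v i \<noteq> \<zero>\<^bsub>R\<^esub>}},
      monoid.mult = undefined, one = undefined,
      ring.zero = (\<lambda>i. \<zero>\<^bsub>R\<^esub>), add = (\<lambda>v w i. v i \<oplus>\<^bsub>R\<^esub> w i), smult = (\<lambda>a v i. a \<otimes>\<^bsub>R\<^esub> v i)\<rparr>"

text \<open>The exact complex \<open>\<dots> \<rightarrow> F 2 \<rightarrow> F 1 \<rightarrow> F 0 \<rightarrow> M \<rightarrow> 0\<close> with augmentation
  \<open>e : F 0 \<rightarrow> M\<close> and differentials \<open>f i : F i \<rightarrow> F (i - 1)\<close> for \<open>i > 0\<close>; the function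
  \<open>f 0\<close> is not used. The augmentation is kept apart since its codomain has a different type.\<close>

definition resolution ::
    "('a, 'r) ring_scheme \<Rightarrow> ('a, 'm, 'c) module_scheme \<Rightarrow> (nat \<Rightarrow> ('a, 'p) module) \<Rightarrow>
     ('p \<Rightarrow> 'm) \<Rightarrow> (nat \<Rightarrow> 'p \<Rightarrow> 'p) \<Rightarrow> bool" where
  "resolution R M F e f \<longleftrightarrow>
     e \<in> lin_hom R (F 0) M \<and> e ` carrier (F 0) = carrier M \<and>
     (\<forall>i. f (Suc i) \<in> lin_hom R (F (Suc i)) (F i)) \<and>
     f 1 ` carrier (F 1) = lin_ker (F 0) M e \<and>
     (\<forall>i. f (Suc (Suc i)) ` carrier (F (Suc (Suc i))) = lin_ker (F (Suc i)) (F i) (f (Suc i)))"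

text \<open>The lifting property. The types of the test modules are no restriction: lifting the
  identity of \<open>P\<close> along the canonical surjection \<open>R\<^bsup>(P)\<^esup> \<rightarrow> P\<close> already exhibits \<open>P\<close> as a direct
  summand of a free module.\<close>

definition projective_module :: "('a, 'r) ring_scheme \<Rightarrow> ('a, 'p) module \<Rightarrow> bool" where
  "projective_module R P \<longleftrightarrow> module R P \<and>
     (\<forall>(N :: ('a, 'p \<Rightarrow> 'a) module) (N' :: ('a, 'p) module) g h.
        module R N \<and> module R N' \<and> g \<in> lin_hom R N N' \<and> g ` carrier N = carrier N' \<and>
        h \<in> lin_hom R P N' \<longrightarrow>
        (\<exists>k \<in> lin_hom R P N. \<forall>x\<in>carrier P. g (k x) = h x))"

text \<open>The modules in the resolutions below live on a fixed type that is large enough for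
  every \<open>M\<close>: each term of a free resolution of \<open>M\<close> can be taken to be a free module on a set of
  cardinality at most the maximum of those of \<open>M\<close>, \<open>R\<close> and the natural numbers, and every
  syzygy is a submodule of such a free module. The infimum of the empty set of lengths is \<open>\<infinity>\<close>.\<close>

definition proj_dim :: "('a, 'r) ring_scheme \<Rightarrow> ('a, 'm, 'c) module_scheme \<Rightarrow> enat" where
  "proj_dim R M = Inf {enat n | n.
     \<exists>(P :: nat \<Rightarrow> ('a, ('m + 'a + nat) \<Rightarrow> 'a) module) e f.
       resolution R M P e f \<and> (\<forall>i. projective_module R (P i)) \<and>
       (\<forall>i>n. carrier (P i) = {\<zero>\<^bsub>P i\<^esub>})}"

text \<open>A resolution by \<open>R\<^bsup>b i\<^esup>\<close> is minimal if the image of \<open>f (i + 1)\<close> lies in \<open>m R\<^bsup>b i\<^esup>\<close>.\<close>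

definition minimal_free_resolution ::
    "('a, 'r) ring_scheme \<Rightarrow> 'a set \<Rightarrow> ('a, 'm, 'c) module_scheme \<Rightarrow> (nat \<Rightarrow> nat) \<Rightarrow>
     ((nat \<Rightarrow> 'a) \<Rightarrow> 'm) \<Rightarrow> (nat \<Rightarrow> (nat \<Rightarrow> 'a) \<Rightarrow> (nat \<Rightarrow> 'a)) \<Rightarrow> bool" where
  "minimal_free_resolution R m M b e f \<longleftrightarrow>
     resolution R M (\<lambda>i. free_module R {..<b i}) e f \<and>
     (\<forall>i. f (Suc i) ` carrier (free_module R {..<b (Suc i)})
            \<subseteq> ideal_smult R m (free_module R {..<b i}))"

text \<open>For \<open>i > 0\<close> the \<open>i\<close>-th syzygy module is the kernel of the map out of \<open>R\<^bsup>b (i - 1)\<^esup>\<close>,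
  which is the augmentation \<open>e\<close> when \<open>i = 1\<close>.\<close>

definition Syz ::
    "('a, 'r) ring_scheme \<Rightarrow> ('a, 'm, 'c) module_scheme \<Rightarrow> (nat \<Rightarrow> nat) \<Rightarrow>
     ((nat \<Rightarrow> 'a) \<Rightarrow> 'm) \<Rightarrow> (nat \<Rightarrow> (nat \<Rightarrow> 'a) \<Rightarrow> (nat \<Rightarrow> 'a)) \<Rightarrow> nat \<Rightarrow> ('a, nat \<Rightarrow> 'a) module" where
  "Syz R M b e f i = (free_module R {..<b (i - 1)})\<lparr>carrier :=
     (if i = 1 then lin_ker (free_module R {..<b 0}) M e
      else lin_ker (free_module R {..<b (i - 1)}) (free_module R {..<b (i - 2)}) (f (i - 1)))\<rparr>"

end

theory Submission
  imports Defs
begin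

text \<open>Write \<open>K\<close> for the \<open>i\<close>-th syzygy module, \<open>F j\<close> for the terms of the minimal resolution and \<open>H\<close> for the
socle \<open>{h. m h = 0}\<close>. Both conclusions reduce to one claim: no localisation of \<open>K\<close> at a prime
vanishes. For the support this is the definition; if \<open>K\<close> had finite length, each element of \<open>m\<close>
would have a power that kills \<open>K\<close>, and \<open>K\<close> would vanish at every prime other than \<open>m\<close>.

So assume that \<open>K\<close> vanishes at a prime \<open>P\<close>. Infinite projective dimension gives \<open>K \<noteq> 0\<close>, hence
\<open>P \<noteq> m\<close>. Since \<open>M\<close> has finite length, some power of each \<open>x \<in> m\<close> kills \<open>M\<close>, so after inverting \<open>x\<close>
the resolution splits and \<open>K\<close> becomes stably free of rank equal to the alternating sum of the
Betti numbers. This is made explicit by maps \<open>D : R\<^sup>q \<rightarrow> R\<^sup>p\<close> that are surjective with kernel \<open>K\<close> up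
to powers of \<open>x\<close>, where \<open>p\<close> and \<open>q\<close> depend on the Betti numbers alone
(\<open>presents_upto\<close>, \<open>kern_presented\<close>). For \<open>x \<notin> P\<close> the vanishing at \<open>P\<close> forces \<open>p = q\<close>
(\<open>locally_zero_dims\<close>). Then \<open>D\<close> is, for every \<open>x \<in> m\<close>, an endomorphism of a noetherian module that
is surjective up to powers of \<open>x\<close>, so it is injective up to powers of \<open>x\<close>, and every element of \<open>K\<close>
is killed by a power of \<open>x\<close> (\<open>locally_zero_torsion\<close>).

Now the Buchsbaum property enters, through two members \<open>x, y\<close> of a system of parameters
(\<open>parameters_exist\<close>): elements killed by a power of \<open>x\<close> lie in \<open>H\<close>, and
\<open>m ((x\<^sup>n) : y\<^sup>k) \<subseteq> (x\<^sup>n)\<close>. In particular \<open>K\<close> has entries in \<open>H\<close>. Three cases remain.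

 \<^item> For the first syzygy module, \<open>K\<close> contains a power of \<open>x\<close> times a basis vector of \<open>F 0\<close>, which
  no element outside \<open>P\<close> kills if \<open>x \<notin> P\<close>.

 \<^item> From the third on, minimality and \<open>m H = 0\<close> show that \<open>H F (i - 2)\<close> consists of cycles, hence of
  boundaries \<open>f v\<close>. Such a \<open>v\<close> satisfies \<open>m v \<subseteq> K\<close>, so \<open>v\<close> itself has entries in \<open>H\<close> and
  \<open>f v = 0\<close>. Thus \<open>H = 0\<close> and \<open>K = 0\<close> (\<open>not_locally_zero_ge_2\<close>).

 \<^item> For the second, \<open>A = f 1\<close> is a square matrix with kernel inside \<open>H F\<close> and cokernel \<open>M\<close>. The colon
  condition, applied to powers of \<open>x\<close> and \<open>y\<close> killing \<open>M\<close>, yields \<open>m F \<subseteq> A F + H F\<close>. Hence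
  \<open>Q F = A (Q F) + H F\<close> for each prime \<open>Q \<noteq> m\<close>, and Nakayama's lemma gives \<open>Q = H\<close>. In dimension at
  least two there are two distinct such primes (\<open>not_locally_zero_1\<close>).\<close>

section \<open>Ideals in noetherian rings\<close>

lemma (in noetherian_ring) exists_maximal_ideal_in:
  assumes "C \<noteq> {}" and C: "\<And>I. I \<in> C \<Longrightarrow> ideal I R"
  shows "\<exists>I\<in>C. \<forall>J\<in>C. I \<subseteq> J \<longrightarrow> J = I"
proof (rule subset_Zorn_nonempty[OF assms(1)])
  fix D assume "D \<noteq> {}" and D: "subset.chain C D"
  then have "subset.chain {I. ideal I R} D"
    using C unfolding pred_on.chain_def by auto
  then have "\<Union>D \<in> D"
    using ideal_chain_is_trivial \<open>D \<noteq> {}\<close> by blast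
  then show "\<Union>D \<in> C"
    using D unfolding pred_on.chain_def by auto
qed

lemma (in noetherian_ring) ideal_noetherian_induct [consumes 1, case_names step]:
  assumes "ideal I R"
    and step: "\<And>I. ideal I R \<Longrightarrow> (\<And>J. ideal J R \<Longrightarrow> I \<subset> J \<Longrightarrow> Q J) \<Longrightarrow> Q I"
  shows "Q I"
proof (rule ccontr)
  assume "\<not> Q I"
  then have "{I. ideal I R \<and> \<not> Q I} \<noteq> {}"
    using assms(1) by auto
  from exists_maximal_ideal_in[OF this]
  obtain I where "ideal I R" "\<not> Q I" "\<And>J. ideal J R \<Longrightarrow> \<not> Q J \<Longrightarrow> I \<subseteq> J \<Longrightarrow> J = I"
    by auto
  then show False
    using step[of I] by blast
qed

lemma (in noetherian_ring) ideal_acc: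
  assumes "\<And>k. ideal (I k) R" and "\<And>k. I k \<subseteq> I (Suc k)"
  shows "\<exists>n. \<forall>k\<ge>n. I k = I n"
proof -
  obtain n where n: "\<And>k. I n \<subseteq> I k \<Longrightarrow> I k = I n"
    using exists_maximal_ideal_in[of "range I"] assms(1) by auto
  have "I n \<subseteq> I k" if "n \<le> k" for k
    using lift_Suc_mono_le[of I, OF assms(2) that] .
  then show ?thesis
    using n by blast
qed

lemma (in cring) ideal_sum_principal:
  assumes "ideal I R" "a \<in> carrier R"
  shows "ideal {i \<oplus> r \<otimes> a | i r. i \<in> I \<and> r \<in> carrier R} R" (is "ideal ?J R")
    and "I \<subseteq> {i \<oplus> r \<otimes> a | i r. i \<in> I \<and> r \<in> carrier R}"
    and "a \<in> {i \<oplus> r \<otimes> a | i r. i \<in> I \<and> r \<in> carrier R}"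
proof -
  interpret I: ideal I R by fact
  have "?J = I <+> PIdl a"
    unfolding set_add_def' cgenideal_def by auto
  then show "ideal ?J R"
    using add_ideals[OF assms(1) cgenideal_ideal[OF assms(2)]] by simp
  show "I \<subseteq> ?J"
  proof
    fix i assume "i \<in> I"
    then have "i = i \<oplus> \<zero> \<otimes> a" using assms I.Icarr by auto
    then show "i \<in> ?J" using \<open>i \<in> I\<close> by blast
  qed
  have "a = \<zero> \<oplus> \<one> \<otimes> a" using assms by auto
  then show "a \<in> ?J"
    using I.zero_closed by blast
qed

lemma primeideal_pow:
  fixes R (structure)
  assumes "primeideal P R" "a \<in> carrier R" "a [^]\<^bsub>R\<^esub> (n::nat) \<in> P"
  shows "a \<in> P"
proof -
  interpret primeideal P R by fact
  show ?thesis using assms(3)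
  proof (induction n)
    case 0 then show ?case using one_imp_carrier I_notcarr by auto
  next
    case (Suc n) then show ?case using I_prime[of "a [^] n" a] assms(2) by auto
  qed
qed

lemma primeideal_one: "primeideal P R \<Longrightarrow> \<one>\<^bsub>R\<^esub> \<notin> P"
  using ideal.one_imp_carrier[of P R] primeideal.I_notcarr[of P R] primeideal.axioms(1)[of P R]
  by auto

lemma primeideal_not_mult:
  fixes R (structure)
  assumes "primeideal P R" "a \<in> carrier R - P" "b \<in> carrier R - P"
  shows "a \<otimes> b \<in> carrier R - P"
proof -
  interpret primeideal P R by fact
  show ?thesis using I_prime[of a b] assms by auto
qed

lemma primeideal_not_pow:
  fixes R (structure)
  assumes "primeideal P R" "a \<in> carrier R - P"
  shows "a [^] (n::nat) \<in> carrier R - P"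
proof -
  interpret primeideal P R by fact
  show ?thesis using primeideal_pow[OF assms(1), of a n] assms by auto
qed

text \<open>Noetherian induction replaces primary decomposition: if \<open>a b \<in> I\<close> with \<open>a, b \<notin> I\<close>, the primes found
for \<open>I + (a)\<close> and for \<open>I + (b)\<close> together serve for \<open>I\<close>, because the product of these two ideals lies
in \<open>I\<close>. This single property of the finite set supplies both the finiteness of the set of minimal
primes and the fact that a radical is an intersection of primes.\<close>
lemma (in cring) radical_cut_out_by_primes:
  assumes "noetherian_ring R" "ideal I R"
  shows "\<exists>\<P>. finite \<P> \<and> (\<forall>P\<in>\<P>. primeideal P R \<and> I \<subseteq> P) \<and>
    (\<forall>r\<in>carrier R. (\<forall>P\<in>\<P>. r \<in> P) \<longrightarrow> (\<exists>n::nat. r [^] n \<in> I))"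
proof -
  interpret noetherian_ring R by fact
  show ?thesis using assms(2)
  proof (induction rule: ideal_noetherian_induct)
    case (step I)
    interpret I: ideal I R by fact
    consider "I = carrier R" | "primeideal I R" |
      a b where "a \<in> carrier R" "b \<in> carrier R" "a \<otimes> b \<in> I" "a \<notin> I" "b \<notin> I"
      using primeidealI[OF step(1) is_cring] by metis
    then show ?case
    proof cases
      case 1
      then show ?thesis
        by (intro exI[of _ "{}"]) auto
    next
      case 2
      then show ?thesis
        by (intro exI[of _ "{I}"]) (auto intro!: exI[of _ "1::nat"])
    next
      case 3
      let ?J = "\<lambda>c. {i \<oplus> r \<otimes> c | i r. i \<in> I \<and> r \<in> carrier R}"
      note Ja = ideal_sum_principal[OF step(1) 3(1)] and Jb = ideal_sum_principal[OF step(1) 3(2)]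
      have lt: "I \<subset> ?J a" "I \<subset> ?J b"
        using Ja(2,3) Jb(2,3) 3(4,5) by blast+
      obtain A where A: "finite A" "\<forall>P\<in>A. primeideal P R \<and> ?J a \<subseteq> P"
        "\<forall>r\<in>carrier R. (\<forall>P\<in>A. r \<in> P) \<longrightarrow> (\<exists>n::nat. r [^] n \<in> ?J a)"
        using step(2)[OF Ja(1) lt(1)] by blast
      obtain B where B: "finite B" "\<forall>P\<in>B. primeideal P R \<and> ?J b \<subseteq> P"
        "\<forall>r\<in>carrier R. (\<forall>P\<in>B. r \<in> P) \<longrightarrow> (\<exists>n::nat. r [^] n \<in> ?J b)"
        using step(2)[OF Jb(1) lt(2)] by blast
      have "\<exists>n::nat. r [^] n \<in> I" if r: "r \<in> carrier R" "\<forall>P\<in>A\<union>B. r \<in> P" for r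
      proof -
        have "\<exists>n::nat. r [^] n \<in> ?J a" "\<exists>n::nat. r [^] n \<in> ?J b"
          using A(3)[THEN bspec, OF r(1)] B(3)[THEN bspec, OF r(1)] r(2) by simp_all
        then obtain n k :: nat where nk: "r [^] n \<in> ?J a" "r [^] k \<in> ?J b"
          by blast
        obtain i s where is1: "r [^] n = i \<oplus> s \<otimes> a" "i \<in> I" "s \<in> carrier R"
          using nk(1) by auto
        obtain j t where jt: "r [^] k = j \<oplus> t \<otimes> b" "j \<in> I" "t \<in> carrier R"
          using nk(2) by auto
        have c: "i \<in> carrier R" "j \<in> carrier R"
          using is1 jt I.Icarr by auto
        have "r [^] (n + k) = (i \<oplus> s \<otimes> a) \<otimes> (j \<oplus> t \<otimes> b)"
          using r is1(1) jt(1) nat_pow_mult[of r n k] by simp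
        also have "\<dots> = i \<otimes> (j \<oplus> t \<otimes> b) \<oplus> (s \<otimes> a) \<otimes> j \<oplus> (s \<otimes> t) \<otimes> (a \<otimes> b)"
          using c is1(3) jt(3) 3(1,2) by algebra
        also have "\<dots> \<in> I"
        proof (intro I.a_closed)
          show "i \<otimes> (j \<oplus> t \<otimes> b) \<in> I"
            using I.I_r_closed is1(2) c jt(3) 3(2) by simp
          show "s \<otimes> a \<otimes> j \<in> I"
            using I.I_l_closed jt(2) is1(3) 3(1) by simp
          show "s \<otimes> t \<otimes> (a \<otimes> b) \<in> I"
            using I.I_l_closed 3(3) is1(3) jt(3) by simp
        qed
        finally show ?thesis by blast
      qed
      moreover have "primeideal P R \<and> I \<subseteq> P" if "P \<in> A \<union> B" for P
      proof -
        have "P \<in> A \<or> P \<in> B" using that unfolding Un_iff .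
        then consider "P \<in> A" | "P \<in> B" by (elim disjE)
        then show ?thesis
        proof cases
          case 1
          note P = A(2)[rule_format, OF 1]
          show ?thesis
            using P[THEN conjunct1] subset_trans[OF psubset_imp_subset[OF lt(1)] P[THEN conjunct2]]
            by (rule conjI)
        next
          case 2
          note P = B(2)[rule_format, OF 2]
          show ?thesis
            using P[THEN conjunct1] subset_trans[OF psubset_imp_subset[OF lt(2)] P[THEN conjunct2]]
            by (rule conjI)
        qed
      qed
      ultimately show ?thesis
        using A(1) B(1) by (intro exI[of _ "A \<union> B"]) simp
    qed
  qed
qed

context noetherian_local_ring
begin

lemma proper_ideal_le:
  assumes "ideal I R" "\<one> \<notin> I"
  shows "I \<subseteq> m"
proof -
  let ?C = "{J. ideal J R \<and> I \<subseteq> J \<and> \<one> \<notin> J}"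
  have "?C \<noteq> {}" using assms by auto
  from exists_maximal_ideal_in[OF this]
  obtain J where J: "ideal J R" "I \<subseteq> J" "\<one> \<notin> J"
    "\<And>J'. ideal J' R \<Longrightarrow> I \<subseteq> J' \<Longrightarrow> \<one> \<notin> J' \<Longrightarrow> J \<subseteq> J' \<Longrightarrow> J' = J"
    by auto
  have "maximalideal J R"
  proof (rule maximalidealI[OF J(1)])
    show "carrier R \<noteq> J" using J(3) by auto
    fix J' assume "ideal J' R" "J \<subseteq> J'" "J' \<subseteq> carrier R"
    then show "J' = J \<or> J' = carrier R"
      using J ideal.one_imp_carrier[of J' R] by blast
  qed
  then show ?thesis using unique_maximal J(2) by blast
qed

lemma m_prime: "primeideal m R"
  using maximalideal_prime maximalideal_axioms by blast

lemma prime_le: "primeideal P R \<Longrightarrow> P \<subseteq> m"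
  using proper_ideal_le[OF primeideal.axioms(1) primeideal_one] .

lemma unit_outside_m:
  assumes "u \<in> carrier R" "u \<notin> m"
  obtains v where "v \<in> carrier R" "v \<otimes> u = \<one>"
proof -
  have "u \<in> PIdl u" "ideal (PIdl u) R"
    using cgenideal_self cgenideal_ideal assms by auto
  then have "\<one> \<in> PIdl u"
    using proper_ideal_le assms by blast
  then show thesis using that unfolding cgenideal_def by auto
qed

lemma one_minus_m:
  assumes "r \<in> m"
  shows "\<one> \<ominus> r \<in> carrier R - m"
proof -
  have r: "r \<in> carrier R" using assms a_Hcarr by auto
  have "\<one> \<ominus> r \<notin> m"
  proof
    assume "\<one> \<ominus> r \<in> m"
    then have "(\<one> \<ominus> r) \<oplus> r \<in> m" using assms a_closed by blast
    moreover have "(\<one> \<ominus> r) \<oplus> r = \<one>" using r by algebra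
    ultimately show False using primeideal_one[OF m_prime] by simp
  qed
  then show ?thesis using r by auto
qed

lemma primes_over_exists:
  assumes "ideal I R"
  obtains \<P> where "finite \<P>" "\<And>P. P \<in> \<P> \<Longrightarrow> primeideal P R \<and> I \<subseteq> P"
    "\<And>r. r \<in> carrier R \<Longrightarrow> (\<And>P. P \<in> \<P> \<Longrightarrow> r \<in> P) \<Longrightarrow> \<exists>n::nat. r [^] n \<in> I"
proof -
  from radical_cut_out_by_primes[OF noetherian_ring_axioms assms] obtain \<P> where
    fin: "finite \<P>" and pr: "\<forall>P\<in>\<P>. primeideal P R \<and> I \<subseteq> P"
    and rad: "\<forall>r\<in>carrier R. (\<forall>P\<in>\<P>. r \<in> P) \<longrightarrow> (\<exists>n::nat. r [^] n \<in> I)"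
    by (elim exE conjE)
  show thesis
  proof (rule that[OF fin])
    show "primeideal P R \<and> I \<subseteq> P" if "P \<in> \<P>" for P
      using bspec[OF pr that] .
    show "\<exists>n::nat. r [^] n \<in> I" if "r \<in> carrier R" "\<And>P. P \<in> \<P> \<Longrightarrow> r \<in> P" for r
    proof -
      have "\<forall>P\<in>\<P>. r \<in> P" using that(2) by (intro ballI)
      then show ?thesis using bspec[OF rad that(1)] by (elim mp)
    qed
  qed
qed

end

section \<open>Prime avoidance and systems of parameters\<close>

context cring
begin

lemma prime_not_containing_inter:
  assumes "finite A" "\<And>P. P \<in> A \<Longrightarrow> ideal P R" "ideal I R" "primeideal Q R"
    and "\<And>P. P \<in> A \<Longrightarrow> \<not> P \<subseteq> Q" "\<not> I \<subseteq> Q"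
  shows "\<exists>z\<in>I. (\<forall>P\<in>A. z \<in> P) \<and> z \<notin> Q"
  using assms(1,2,5)
proof (induction A rule: finite_induct)
  case empty
  then show ?case using assms(6) by auto
next
  case (insert P A)
  interpret Q: primeideal Q R by fact
  interpret I: ideal I R by fact
  have "\<exists>z\<in>I. (\<forall>P\<in>A. z \<in> P) \<and> z \<notin> Q"
    using insert.IH insert.prems by simp
  then obtain z where z: "z \<in> I" "\<And>P. P \<in> A \<Longrightarrow> z \<in> P" "z \<notin> Q" by blast
  obtain y where y: "y \<in> P" "y \<notin> Q" using insert.prems(2)[of P] by auto
  interpret P: ideal P R using insert.prems(1)[of P] by simp
  have c: "z \<in> carrier R" "y \<in> carrier R" using z y by auto
  have "z \<otimes> y \<notin> Q" using Q.I_prime[OF c] z y by auto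
  moreover have "z \<otimes> y \<in> I" using I.I_r_closed z c by simp
  moreover have "z \<otimes> y \<in> P'" if "P' \<in> insert P A" for P'
  proof (cases "P' = P")
    case True then show ?thesis using P.I_l_closed y c by simp
  next
    case False
    then have "P' \<in> A" using that by simp
    then show ?thesis using ideal.I_r_closed[OF insert.prems(1)[OF that]] z(2) c by simp
  qed
  ultimately show ?case by blast
qed

text \<open>For pairwise incomparable primes the induction needs no choice of which prime to drop: if the
element found so far lies in the new prime, adding an element of the old primes outside the new one
repairs it.\<close>
lemma prime_avoidance:
  assumes "finite A" "\<And>P. P \<in> A \<Longrightarrow> primeideal P R" "ideal I R"
    and "\<And>P. P \<in> A \<Longrightarrow> \<not> I \<subseteq> P"
    and "\<And>P Q. P \<in> A \<Longrightarrow> Q \<in> A \<Longrightarrow> P \<subseteq> Q \<Longrightarrow> P = Q"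
  shows "\<exists>x\<in>I. \<forall>P\<in>A. x \<notin> P"
  using assms(1,2,4,5)
proof (induction A rule: finite_induct)
  case empty
  then show ?case using assms(3) additive_subgroup.zero_closed ideal.axioms(1) by fastforce
next
  case (insert Q A)
  interpret I: ideal I R by fact
  have Q: "primeideal Q R" using insert.prems by simp
  interpret Q: primeideal Q R by fact
  have "\<exists>x\<in>I. \<forall>P\<in>A. x \<notin> P"
    by (rule insert.IH) (use insert.prems in simp_all)
  then obtain x where x: "x \<in> I" "\<And>P. P \<in> A \<Longrightarrow> x \<notin> P" by blast
  show ?case
  proof (cases "x \<in> Q")
    case False
    then show ?thesis using x by auto
  next
    case True
    have "\<not> P \<subseteq> Q" if "P \<in> A" for P
      using insert.prems(3)[of P Q] insert.hyps(2) that by auto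
    then have "\<exists>z\<in>I. (\<forall>P\<in>A. z \<in> P) \<and> z \<notin> Q"
      using prime_not_containing_inter[OF insert.hyps(1) _ assms(3) Q]
        primeideal.axioms(1)[OF insert.prems(1)] insert.prems(2) by simp
    then obtain z where z: "z \<in> I" "\<And>P. P \<in> A \<Longrightarrow> z \<in> P" "z \<notin> Q" by blast
    have c: "x \<in> carrier R" "z \<in> carrier R" using x z by auto
    have cancel: "b \<in> P" if "ideal P R" "a \<in> P" "a \<oplus> b \<in> P" "b \<in> carrier R" for a b P
    proof -
      interpret P: ideal P R by fact
      have "b = (a \<oplus> b) \<oplus> \<ominus> a" using that P.a_Hcarr[OF that(2)] by algebra
      also have "\<dots> \<in> P" using that P.a_inv_closed P.a_closed by simp
      finally show ?thesis .
    qed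
    have "x \<oplus> z \<notin> Q" using cancel[OF Q.ideal_axioms True _ c(2)] z by blast
    moreover have "x \<oplus> z \<notin> P" if "P \<in> A" for P
      using cancel[of P z x] insert.prems(1)[of P] primeideal.axioms(1) that z(2) x(2) c
      by (auto simp: a_comm)
    ultimately show ?thesis using x z by (auto intro!: bexI[of _ "x \<oplus> z"])
  qed
qed

end

context noetherian_local_ring
begin

text \<open>The Krull dimension of \<open>R / (S)\<close> is at most \<open>n\<close>, phrased through primes of \<open>R\<close>.\<close>
definition chain_bound :: "'a set \<Rightarrow> nat \<Rightarrow> bool" where
  "chain_bound S n \<longleftrightarrow> (\<forall>p k. (\<forall>i\<le>k. primeideal (p i) R \<and> S \<subseteq> p i) \<longrightarrow>
     (\<forall>i<k. p i \<subset> p (Suc i)) \<longrightarrow> k \<le> n)"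

lemma minimal_primes_exist:
  assumes "S \<subseteq> carrier R"
  obtains \<Q> where "finite \<Q>" "\<And>Q. Q \<in> \<Q> \<Longrightarrow> primeideal Q R \<and> S \<subseteq> Q"
    "\<And>P Q. P \<in> \<Q> \<Longrightarrow> Q \<in> \<Q> \<Longrightarrow> P \<subseteq> Q \<Longrightarrow> P = Q"
    "\<And>p. primeideal p R \<Longrightarrow> S \<subseteq> p \<Longrightarrow> \<exists>Q\<in>\<Q>. Q \<subseteq> p"
proof -
  have I: "ideal (Idl S) R" and SI: "S \<subseteq> Idl S"
    using genideal_ideal genideal_self assms by auto
  obtain A where A: "finite A" "\<And>P. P \<in> A \<Longrightarrow> primeideal P R \<and> Idl S \<subseteq> P"
    "\<And>r. r \<in> carrier R \<Longrightarrow> (\<And>P. P \<in> A \<Longrightarrow> r \<in> P) \<Longrightarrow> \<exists>n::nat. r [^] n \<in> Idl S"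
    using primes_over_exists[OF I] by metis
  define \<Q> where "\<Q> = {P\<in>A. \<forall>P'\<in>A. P' \<subseteq> P \<longrightarrow> P' = P}"
  show thesis
  proof (rule that)
    show "finite \<Q>" using A(1) unfolding \<Q>_def by simp
    show "primeideal Q R \<and> S \<subseteq> Q" if "Q \<in> \<Q>" for Q
      using that A(2)[of Q] SI unfolding \<Q>_def by blast
    show "P = Q" if "P \<in> \<Q>" "Q \<in> \<Q>" "P \<subseteq> Q" for P Q
      using that unfolding \<Q>_def by auto
    fix p assume p: "primeideal p R" "S \<subseteq> p"
    have Ip: "Idl S \<subseteq> p" using genideal_minimal p primeideal.axioms(1) by blast
    have "\<exists>P\<in>A. P \<subseteq> p"
    proof (rule ccontr)
      assume "\<not> (\<exists>P\<in>A. P \<subseteq> p)"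
      then have "\<exists>z\<in>carrier R. (\<forall>P\<in>A. z \<in> P) \<and> z \<notin> p"
        using prime_not_containing_inter[OF A(1) _ oneideal p(1)] A(2) primeideal.axioms(1)
          primeideal_one[OF p(1)] one_closed by blast
      then obtain z where z: "z \<in> carrier R" "\<And>P. P \<in> A \<Longrightarrow> z \<in> P" "z \<notin> p" by blast
      obtain n :: nat where "z [^] n \<in> Idl S" using A(3)[OF z(1,2)] by auto
      then show False using primeideal_pow[OF p(1) z(1)] Ip z(3) by blast
    qed
    then obtain P where P: "P \<in> A" "P \<subseteq> p" by blast
    obtain Q where Q: "Q \<in> A" "Q \<subseteq> P" "\<forall>P'\<in>A. P' \<subseteq> Q \<longrightarrow> Q = P'"
      using finite_has_minimal2[OF A(1) P(1)] by blast
    have "Q \<in> \<Q>" using Q unfolding \<Q>_def by auto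
    then show "\<exists>Q\<in>\<Q>. Q \<subseteq> p" using Q P by blast
  qed
qed

text \<open>An element of \<open>m\<close> outside all minimal primes over \<open>S\<close> lowers the dimension, since every chain above
it can be prolonged downwards by a minimal prime. If \<open>m\<close> itself is minimal over \<open>S\<close> the
dimension is already zero, and \<open>\<zero>\<close> serves: padding with zeros is harmless because a system of
parameters is only required to have the right length and radical.\<close>
lemma chain_bound_step:
  assumes "S \<subseteq> m" "chain_bound S (Suc n)"
  shows "\<exists>x\<in>m. chain_bound (insert x S) n"
proof -
  have "S \<subseteq> carrier R" using assms(1) a_subset by blast
  then obtain \<Q> where Q: "finite \<Q>" "\<And>Q. Q \<in> \<Q> \<Longrightarrow> primeideal Q R \<and> S \<subseteq> Q"
    "\<And>P Q. P \<in> \<Q> \<Longrightarrow> Q \<in> \<Q> \<Longrightarrow> P \<subseteq> Q \<Longrightarrow> P = Q"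
    "\<And>p. primeideal p R \<Longrightarrow> S \<subseteq> p \<Longrightarrow> \<exists>Q\<in>\<Q>. Q \<subseteq> p"
    by (rule minimal_primes_exist) blast
  show ?thesis
  proof (cases "m \<in> \<Q>")
    case True
    have eq: "p = m" if p: "primeideal p R" "S \<subseteq> p" for p
    proof -
      obtain Q where q: "Q \<in> \<Q>" "Q \<subseteq> p" using Q(4)[OF p] by blast
      have "p \<subseteq> m" using prime_le p by blast
      then have "Q = m" using Q(3)[OF q(1) True] q by blast
      then show ?thesis using q \<open>p \<subseteq> m\<close> by blast
    qed
    have "chain_bound (insert \<zero> S) n"
      unfolding chain_bound_def
    proof (intro allI impI)
      fix p k assume p: "\<forall>i\<le>k. primeideal (p i) R \<and> insert \<zero> S \<subseteq> p i" "\<forall>i<k. p i \<subset> p (Suc i)"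
      show "k \<le> n"
      proof (cases "k = 0")
        case False
        have "p 0 = m" "p (Suc 0) = m" using p(1)[rule_format, of 0] p(1)[rule_format, of 1] False eq
          by auto
        then show ?thesis using p(2)[rule_format, of 0] False by auto
      qed simp
    qed
    then show ?thesis using zero_closed by blast
  next
    case False
    have "\<not> m \<subseteq> P" if "P \<in> \<Q>" for P
    proof
      assume "m \<subseteq> P"
      then have "P = m" using Q(2)[OF that] prime_le[of P] by simp
      then show False using False that by simp
    qed
    then obtain x where x: "x \<in> m" "\<And>P. P \<in> \<Q> \<Longrightarrow> x \<notin> P"
    proof -
      have "\<exists>x\<in>m. \<forall>P\<in>\<Q>. x \<notin> P"
        by (rule prime_avoidance[OF Q(1) _ ideal_axioms])
          (use Q(2) Q(3) \<open>\<And>P. P \<in> \<Q> \<Longrightarrow> \<not> m \<subseteq> P\<close> in simp_all)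
      then show thesis using that by blast
    qed
    have "chain_bound (insert x S) n"
      unfolding chain_bound_def
    proof (intro allI impI)
      fix p k assume p: "\<forall>i\<le>k. primeideal (p i) R \<and> insert x S \<subseteq> p i" "\<forall>i<k. p i \<subset> p (Suc i)"
      have p0: "primeideal (p 0) R" "S \<subseteq> p 0" "x \<in> p 0" using p(1)[rule_format, of 0] by auto
      obtain q where q: "q \<in> \<Q>" "q \<subseteq> p 0" using Q(4)[OF p0(1,2)] by blast
      define p' where "p' = (\<lambda>i. case i of 0 \<Rightarrow> q | Suc j \<Rightarrow> p j)"
      have "primeideal (p' i) R \<and> S \<subseteq> p' i" if "i \<le> Suc k" for i
        using that p(1) Q(2)[OF q(1)] unfolding p'_def by (cases i) simp_all
      moreover have "p' i \<subset> p' (Suc i)" if "i < Suc k" for i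
        using that p(2) q x p0 unfolding p'_def by (cases i) auto
      ultimately show "k \<le> n"
        using assms(2) unfolding chain_bound_def by (metis Suc_le_mono)
    qed
    then show ?thesis using x by blast
  qed
qed

lemma chain_bound_list:
  assumes "S \<subseteq> m" "chain_bound S n"
  shows "\<exists>xs. length xs = n \<and> set xs \<subseteq> m \<and> chain_bound (set xs \<union> S) 0"
  using assms
proof (induction n arbitrary: S)
  case 0
  then show ?case by (intro exI[of _ "[]"]) simp
next
  case (Suc n)
  obtain x where x: "x \<in> m" "chain_bound (insert x S) n" using chain_bound_step[OF Suc.prems] by blast
  then obtain xs where "length xs = n" "set xs \<subseteq> m" "chain_bound (set xs \<union> insert x S) 0"
    using Suc.IH[of "insert x S"] Suc.prems(1) by auto
  then show ?case using x by (intro exI[of _ "x # xs"]) simp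
qed

lemma chain_bound_krull_dim:
  assumes "krull_dim R = enat d"
  shows "chain_bound {} d"
  unfolding chain_bound_def
proof (intro allI impI)
  fix p k assume "\<forall>i\<le>k. primeideal (p i) R \<and> {} \<subseteq> p i" "\<forall>i<k. p i \<subset> p (Suc i)"
  then have "enat k \<le> krull_dim R"
    unfolding krull_dim_def Spec_def by (intro Sup_upper) auto
  then show "k \<le> d" using assms by simp
qed

lemma sop_exists:
  assumes "krull_dim R = enat d"
  obtains xs where "length xs = d" "set xs \<subseteq> m"
    "\<And>P. primeideal P R \<Longrightarrow> set xs \<subseteq> P \<Longrightarrow> P = m"
proof -
  obtain xs where xs: "length xs = d" "set xs \<subseteq> m" "chain_bound (set xs) 0"
    using chain_bound_list[OF _ chain_bound_krull_dim[OF assms]] by auto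
  have "P = m" if P: "primeideal P R" "set xs \<subseteq> P" for P
  proof (rule ccontr)
    assume "P \<noteq> m"
    define p where "p i = (if i = 0 then P else m)" for i :: nat
    have "\<forall>i\<le>1. primeideal (p i) R \<and> set xs \<subseteq> p i" "\<forall>i<1. p i \<subset> p (Suc i)"
      unfolding p_def using P xs m_prime prime_le \<open>P \<noteq> m\<close> by auto
    then have "1 \<le> (0::nat)" using xs(3) unfolding chain_bound_def by blast
    then show False by simp
  qed
  then show thesis using that xs by blast
qed

lemma sopI:
  assumes "enat (length xs) = krull_dim R" "set xs \<subseteq> m"
    and "\<And>P. primeideal P R \<Longrightarrow> set xs \<subseteq> P \<Longrightarrow> P = m"
  shows "system_of_parameters R m xs"
proof -
  have c: "set xs \<subseteq> carrier R" using assms(2) a_subset by blast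
  have I: "ideal (Idl (set xs)) R" "Idl (set xs) \<subseteq> m" "set xs \<subseteq> Idl (set xs)"
    using genideal_ideal[OF c] genideal_minimal[OF ideal_axioms assms(2)] genideal_self[OF c] by auto
  obtain A where A: "\<And>P. P \<in> A \<Longrightarrow> primeideal P R \<and> Idl (set xs) \<subseteq> P"
    "\<And>r. r \<in> carrier R \<Longrightarrow> (\<And>P. P \<in> A \<Longrightarrow> r \<in> P) \<Longrightarrow> \<exists>n::nat. r [^] n \<in> Idl (set xs)"
    using primes_over_exists[OF I(1)] by metis
  have "P = m" if "P \<in> A" for P using A(1)[OF that] assms(3)[of P] I(3) by blast
  then have "r \<in> ideal_radical R (Idl (set xs))" if "r \<in> m" for r
    using A(2)[of r] that a_Hcarr unfolding ideal_radical_def by auto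
  moreover have "r \<in> m" if "r \<in> ideal_radical R (Idl (set xs))" for r
    using that primeideal_pow[OF m_prime] I(2) unfolding ideal_radical_def by blast
  ultimately show ?thesis
    unfolding system_of_parameters_def using assms by blast
qed

text \<open>Nakayama's lemma in the form: if \<open>P \<subseteq> m P + H\<close>, then \<open>P = H\<close>, with \<open>m P + H\<close> described by the
ideals containing it. Finite generation enters as the existence of an ideal maximal among
those properly between, so that \<open>P / J\<close> is simple and hence killed by \<open>m\<close>.\<close>
lemma noetherian_nakayama:
  assumes "ideal P R" "ideal H R" "H \<subseteq> P"
    and "\<And>J. ideal J R \<Longrightarrow> H \<subseteq> J \<Longrightarrow> (\<And>a p. a \<in> m \<Longrightarrow> p \<in> P \<Longrightarrow> a \<otimes> p \<in> J) \<Longrightarrow> P \<subseteq> J"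
  shows "P = H"
proof (rule ccontr)
  assume ne: "P \<noteq> H"
  let ?C = "{J. ideal J R \<and> H \<subseteq> J \<and> J \<subset> P}"
  have "?C \<noteq> {}" using ne assms by auto
  then have "\<exists>J\<in>?C. \<forall>J'\<in>?C. J \<subseteq> J' \<longrightarrow> J' = J"
    by (rule exists_maximal_ideal_in) simp
  then obtain J where JC: "J \<in> ?C" and mxC: "\<forall>J'\<in>?C. J \<subseteq> J' \<longrightarrow> J' = J"
    by (elim bexE)
  from JC have J: "ideal J R" "H \<subseteq> J" "J \<subset> P" by blast+
  have mx: "J' = J" if "ideal J' R" "H \<subseteq> J'" "J' \<subset> P" "J \<subseteq> J'" for J'
    using mxC that by blast
  interpret P: ideal P R by fact
  interpret J: ideal J R by fact
  have "a \<otimes> p \<in> J" if a: "a \<in> m" and p: "p \<in> P" for a p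
  proof (rule ccontr)
    assume n: "a \<otimes> p \<notin> J"
    have ac: "a \<in> carrier R" "p \<in> carrier R" using a p by auto
    have apc: "a \<otimes> p \<in> carrier R" using ac by simp
    let ?K = "{i \<oplus> r \<otimes> (a \<otimes> p) | i r. i \<in> J \<and> r \<in> carrier R}"
    note K = ideal_sum_principal[OF J(1) apc]
    have "?K \<subseteq> P"
    proof
      fix z assume "z \<in> ?K"
      then obtain i r where "z = i \<oplus> r \<otimes> (a \<otimes> p)" "i \<in> J" "r \<in> carrier R" by auto
      then show "z \<in> P" using J(3) P.a_closed P.I_l_closed p ac by auto
    qed
    then have "?K = P" using mx[OF K(1)] K(2,3) J(2) n by blast
    then obtain i r where ir: "p = i \<oplus> r \<otimes> (a \<otimes> p)" "i \<in> J" "r \<in> carrier R" using p by auto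
    have ic: "i \<in> carrier R" using ir by auto
    have ra: "r \<otimes> a \<in> m" using a ir I_l_closed by simp
    obtain v where v: "v \<in> carrier R" "v \<otimes> (\<one> \<ominus> r \<otimes> a) = \<one>"
      using one_minus_m[OF ra] unit_outside_m by blast
    have "p = (v \<otimes> (\<one> \<ominus> r \<otimes> a)) \<otimes> p" using v ac by simp
    also have "\<dots> = v \<otimes> (p \<ominus> r \<otimes> (a \<otimes> p))"
      using v(1) ac ir(3) by algebra
    also have "\<dots> = v \<otimes> ((i \<oplus> r \<otimes> (a \<otimes> p)) \<ominus> r \<otimes> (a \<otimes> p))"
      using ir(1) by (rule arg_cong)
    also have "\<dots> = v \<otimes> i" using ic ir(3) apc v(1) by algebra
    also have "\<dots> \<in> J" using J.I_l_closed ir v by simp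
    finally have "a \<otimes> p \<in> J" using J.I_l_closed ac by simp
    then show False using n by simp
  qed
  then have "P \<subseteq> J" using assms(4)[OF J(1,2)] by blast
  then show False using J(3) by blast
qed

definition socle :: "'a set" where
  "socle = {h \<in> carrier R. \<forall>a\<in>m. a \<otimes> h = \<zero>}"

lemma socle_ideal: "ideal socle R"
proof (rule idealI[OF ring_axioms])
  show "subgroup socle (add_monoid R)"
    unfolding socle_def
    by (rule add.subgroupI) (auto simp: r_distr r_minus a_inv_def[symmetric] intro: exI[of _ \<zero>])
next
  fix h x assume h: "h \<in> socle" "x \<in> carrier R"
  have "a \<otimes> (x \<otimes> h) = x \<otimes> (a \<otimes> h)" if "a \<in> m" for a
    using that h unfolding socle_def by (intro m_lcomm) auto
  then show "x \<otimes> h \<in> socle" using h unfolding socle_def by auto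
  then show "h \<otimes> x \<in> socle" using h m_comm[of h x] unfolding socle_def by simp
qed

end

text \<open>Powers of the members of a system of parameters form again a system of parameters, so the first two
conditions of a weak sequence hold for all exponents. The first says that the torsion with
respect to \<open>x\<close> is the socle; thus the local cohomology \<open>H\<^sup>0\<^sub>m(R)\<close> is killed by \<open>m\<close>.\<close>
lemma (in buchsbaum_local_ring) parameters_exist:
  assumes "krull_dim R = enat d" "d > 1"
  obtains x y where "x \<in> m" "y \<in> m"
    "\<forall>n::nat. \<forall>r\<in>carrier R. x [^] n \<otimes> r = \<zero> \<longrightarrow> r \<in> socle"
    "\<forall>(n::nat) (k::nat). \<forall>r\<in>carrier R. \<forall>s\<in>carrier R. \<forall>a\<in>m.
       y [^] k \<otimes> r = x [^] n \<otimes> s \<longrightarrow> (\<exists>t\<in>carrier R. a \<otimes> r = x [^] n \<otimes> t)"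
proof -
  obtain xs where xs: "length xs = d" "set xs \<subseteq> m" "\<And>P. primeideal P R \<Longrightarrow> set xs \<subseteq> P \<Longrightarrow> P = m"
    using sop_exists[OF assms(1)] by metis
  obtain x y zs where xyz: "xs = x # y # zs"
    using xs(1) assms(2) by (metis One_nat_def Suc_le_length_iff Suc_less_eq2 Suc_leI)
  have xy: "x \<in> m" "y \<in> m" using xs(2) xyz by auto
  then have xyc: "x \<in> carrier R" "y \<in> carrier R" by auto
  have pm: "z [^] Suc n \<in> m" if "z \<in> m" for z n
    using that I_l_closed by auto
  have w: "weak_sequence R m (x [^] Suc n # y [^] Suc k # zs)" for n k :: nat
  proof (rule sop_weak_sequence, rule sopI)
    show "enat (length (x [^] Suc n # y [^] Suc k # zs)) = krull_dim R"
      using xs(1) xyz assms(1) by simp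
    show "set (x [^] Suc n # y [^] Suc k # zs) \<subseteq> m"
      using pm[OF xy(1)] pm[OF xy(2)] xs(2) xyz by simp
    fix P assume P: "primeideal P R" "set (x [^] Suc n # y [^] Suc k # zs) \<subseteq> P"
    then have "x \<in> P" "y \<in> P"
      using primeideal_pow[OF P(1) xyc(1), of "Suc n"] primeideal_pow[OF P(1) xyc(2), of "Suc k"]
      by simp_all
    then show "P = m" using xs(3)[OF P(1)] xyz P(2) by simp
  qed
  have Idl0: "Idl {} = {\<zero>}"
    using genideal_minimal[OF zeroideal, of "{}"] genideal_ideal[of "{}"]
      additive_subgroup.zero_closed ideal.axioms(1) by blast
  have w0: "a \<otimes> r = \<zero>" if "a \<in> m" "r \<in> carrier R" "x [^] Suc n \<otimes> r = \<zero>" for a r n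
  proof -
    have "r \<in> ideal_colon R (Idl {}) (x [^] Suc n)"
      unfolding ideal_colon_def Idl0 using that xyc by (simp add: m_comm del: nat_pow_Suc)
    then have "a \<otimes> r \<in> m \<cdot> ideal_colon R (Idl {}) (x [^] Suc n)"
      using that(1) by (rule ideal_prod.prod[rotated])
    also have "\<dots> \<subseteq> Idl {}"
      using w[of n 0, unfolded weak_sequence_def, THEN conjunct2, rule_format, of 0] by simp
    finally show ?thesis using Idl0 by simp
  qed
  have w1: "\<exists>t\<in>carrier R. a \<otimes> r = x [^] Suc n \<otimes> t"
    if "a \<in> m" "r \<in> carrier R" "s \<in> carrier R" "y [^] Suc k \<otimes> r = x [^] Suc n \<otimes> s" for a r s n k
  proof -
    have xc: "x [^] Suc n \<in> carrier R" using xyc by blast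
    have Idl1: "Idl {x [^] Suc n} = {t \<otimes> x [^] Suc n | t. t \<in> carrier R}"
      using cgenideal_eq_genideal[OF xc] unfolding cgenideal_def by simp
    have "r \<otimes> y [^] Suc k = s \<otimes> x [^] Suc n"
      using that xyc m_comm by (metis nat_pow_closed)
    then have "r \<in> ideal_colon R (Idl {x [^] Suc n}) (y [^] Suc k)"
      unfolding ideal_colon_def Idl1 using that by blast
    then have "a \<otimes> r \<in> m \<cdot> ideal_colon R (Idl {x [^] Suc n}) (y [^] Suc k)"
      using that(1) by (rule ideal_prod.prod[rotated])
    also have "\<dots> \<subseteq> Idl {x [^] Suc n}"
      using w[of n k, unfolded weak_sequence_def, THEN conjunct2, rule_format, of 1] by simp
    finally show ?thesis unfolding Idl1 using m_comm xc by auto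
  qed
  show thesis
  proof (rule that[OF xy]; intro allI ballI impI)
    show "r \<in> socle" if r: "r \<in> carrier R" "x [^] n \<otimes> r = \<zero>" for n :: nat and r
    proof -
      have "x [^] Suc n \<otimes> r = x \<otimes> (x [^] n \<otimes> r)"
        using r(1) xyc by (simp add: m_ac)
      then show ?thesis unfolding socle_def using w0[of _ r n] r xyc by simp
    qed
    show "\<exists>t\<in>carrier R. a \<otimes> r = x [^] n \<otimes> t" if h: "r \<in> carrier R" "s \<in> carrier R" "a \<in> m"
      "y [^] k \<otimes> r = x [^] n \<otimes> s" for n k :: nat and r s a
    proof (cases n)
      case 0
      then show ?thesis using h by auto
    next
      case (Suc n')
      have "y [^] Suc k \<otimes> r = y \<otimes> (y [^] k \<otimes> r)" using h(1) xyc by (simp add: m_ac)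
      also have "\<dots> = x [^] n \<otimes> (y \<otimes> s)" unfolding h(4) using h(2) xyc by (simp add: m_lcomm)
      finally show ?thesis using w1[of a r "y \<otimes> s" k n'] Suc h xyc by simp
    qed
  qed
qed

section \<open>Linear maps and free modules\<close>

lemma lin_homI:
  assumes "\<And>x. x \<in> carrier M \<Longrightarrow> h x \<in> carrier N"
    and "\<And>x y. x \<in> carrier M \<Longrightarrow> y \<in> carrier M \<Longrightarrow> h (x \<oplus>\<^bsub>M\<^esub> y) = h x \<oplus>\<^bsub>N\<^esub> h y"
    and "\<And>a x. a \<in> carrier R \<Longrightarrow> x \<in> carrier M \<Longrightarrow> h (a \<odot>\<^bsub>M\<^esub> x) = a \<odot>\<^bsub>N\<^esub> h x"
  shows "h \<in> lin_hom R M N"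
  using assms unfolding lin_hom_def by auto

lemma lin_hom_closed: "h \<in> lin_hom R M N \<Longrightarrow> x \<in> carrier M \<Longrightarrow> h x \<in> carrier N"
  and lin_hom_add: "h \<in> lin_hom R M N \<Longrightarrow> x \<in> carrier M \<Longrightarrow> y \<in> carrier M \<Longrightarrow>
    h (x \<oplus>\<^bsub>M\<^esub> y) = h x \<oplus>\<^bsub>N\<^esub> h y"
  and lin_hom_smult: "h \<in> lin_hom R M N \<Longrightarrow> a \<in> carrier R \<Longrightarrow> x \<in> carrier M \<Longrightarrow>
    h (a \<odot>\<^bsub>M\<^esub> x) = a \<odot>\<^bsub>N\<^esub> h x"
  unfolding lin_hom_def by auto

lemma lin_hom_zero:
  assumes "module R M" "module R N" "h \<in> lin_hom R M N"
  shows "h \<zero>\<^bsub>M\<^esub> = \<zero>\<^bsub>N\<^esub>"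
proof -
  interpret M: module R M by fact
  interpret N: module R N by fact
  have "h (\<zero>\<^bsub>R\<^esub> \<odot>\<^bsub>M\<^esub> \<zero>\<^bsub>M\<^esub>) = \<zero>\<^bsub>R\<^esub> \<odot>\<^bsub>N\<^esub> h \<zero>\<^bsub>M\<^esub>"
    by (rule lin_hom_smult[OF assms(3)]) simp_all
  then show ?thesis using lin_hom_closed[OF assms(3)] by simp
qed

lemma lin_hom_comp:
  assumes "g \<in> lin_hom R L M" "h \<in> lin_hom R M N"
  shows "(\<lambda>x. h (g x)) \<in> lin_hom R L N"
  using assms unfolding lin_hom_def by (auto simp: Pi_iff)

lemma (in module) neg_smult: "x \<in> carrier M \<Longrightarrow> (\<ominus>\<^bsub>R\<^esub> \<one>\<^bsub>R\<^esub>) \<odot>\<^bsub>M\<^esub> x = \<ominus>\<^bsub>M\<^esub> x"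
  using smult_l_minus[of "\<one>\<^bsub>R\<^esub>" x] by simp

lemma (in module) submoduleI':
  assumes "N \<subseteq> carrier M" "\<zero>\<^bsub>M\<^esub> \<in> N"
    "\<And>x y. x \<in> N \<Longrightarrow> y \<in> N \<Longrightarrow> x \<oplus>\<^bsub>M\<^esub> y \<in> N"
    "\<And>a x. a \<in> carrier R \<Longrightarrow> x \<in> N \<Longrightarrow> a \<odot>\<^bsub>M\<^esub> x \<in> N"
  shows "submodule N R M"
proof (rule submoduleI)
  show "\<ominus>\<^bsub>M\<^esub> a \<in> N" if "a \<in> N" for a
    using assms(4)[of "\<ominus>\<^bsub>R\<^esub> \<one>\<^bsub>R\<^esub>" a] that neg_smult[of a] assms(1) by auto
qed (use assms in auto)

lemma lin_ker_submodule:
  assumes "module R M" "module R N" "h \<in> lin_hom R M N"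
  shows "submodule (lin_ker M N h) R M"
proof -
  interpret M: module R M by fact
  interpret N: module R N by fact
  show ?thesis
    by (rule M.submoduleI')
      (auto simp: lin_ker_def lin_hom_add[OF assms(3)] lin_hom_smult[OF assms(3)] lin_hom_zero[OF assms])
qed

lemma free_module_simps [simp]:
  "\<zero>\<^bsub>free_module R S\<^esub> = (\<lambda>i. \<zero>\<^bsub>R\<^esub>)"
  "v \<oplus>\<^bsub>free_module R S\<^esub> w = (\<lambda>i. v i \<oplus>\<^bsub>R\<^esub> w i)"
  "a \<odot>\<^bsub>free_module R S\<^esub> v = (\<lambda>i. a \<otimes>\<^bsub>R\<^esub> v i)"
  unfolding free_module_def by simp_all

lemma free_module_carrier:
  "finite S \<Longrightarrow> v \<in> carrier (free_module R S) \<longleftrightarrow> (\<forall>i. v i \<in> carrier R) \<and> (\<forall>i. i \<notin> S \<longrightarrow> v i = \<zero>\<^bsub>R\<^esub>)"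
  unfolding free_module_def by (auto elim: finite_subset[rotated])

lemma free_module_closed: "v \<in> carrier (free_module R S) \<Longrightarrow> v i \<in> carrier R"
  unfolding free_module_def by auto

lemma free_module_outside: "v \<in> carrier (free_module R S) \<Longrightarrow> i \<notin> S \<Longrightarrow> v i = \<zero>\<^bsub>R\<^esub>"
  unfolding free_module_def by auto

definition unit_vec :: "('a, 'r) ring_scheme \<Rightarrow> 'i \<Rightarrow> 'i \<Rightarrow> 'a" where
  "unit_vec R i = (\<lambda>j. if j = i then \<one>\<^bsub>R\<^esub> else \<zero>\<^bsub>R\<^esub>)"

context cring
begin

lemma free_module_module:
  assumes "finite S"
  shows "module R (free_module R S)"
proof (rule moduleI)
  note c = free_module_carrier[OF assms]
  show "abelian_group (free_module R S)"
  proof (rule abelian_groupI)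
    show "\<exists>y\<in>carrier (free_module R S). y \<oplus>\<^bsub>free_module R S\<^esub> x = \<zero>\<^bsub>free_module R S\<^esub>"
      if "x \<in> carrier (free_module R S)" for x
      using that by (intro bexI[of _ "\<lambda>i. \<ominus> x i"]) (auto simp: c l_neg)
  qed (auto simp: c a_ac)
qed (auto simp: free_module_carrier[OF assms] l_distr r_distr m_assoc is_cring)

lemma unit_vec_carrier: "finite S \<Longrightarrow> i \<in> S \<Longrightarrow> unit_vec R i \<in> carrier (free_module R S)"
  unfolding unit_vec_def by (auto simp: free_module_carrier)

text \<open>Induction principle replacing expansions \<open>v = \<Sum> v i e i\<close>: additively closed sets that contain all
terms contain the vector. It avoids sums in a module.\<close>
lemma free_module_span:
  assumes "finite S" "v \<in> carrier (free_module R S)"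
    and "(\<lambda>i. \<zero>) \<in> N" "\<And>v w. v \<in> N \<Longrightarrow> w \<in> N \<Longrightarrow> (\<lambda>i. v i \<oplus> w i) \<in> N"
    and "\<And>i. i \<in> S \<Longrightarrow> (\<lambda>j. v i \<otimes> unit_vec R i j) \<in> N"
  shows "v \<in> N"
  using assms(1,2,5)
proof (induction S arbitrary: v rule: finite_induct)
  case empty
  then have "v = (\<lambda>i. \<zero>)" by (auto simp: free_module_carrier)
  then show ?case using assms(3) by simp
next
  case (insert s S)
  have c: "\<And>i. v i \<in> carrier R" "\<And>i. i \<notin> insert s S \<Longrightarrow> v i = \<zero>"
    using insert.prems(1) insert.hyps(1) by (auto simp: free_module_carrier)
  define w where "w = v(s := \<zero>)"
  have "w \<in> N"
  proof (rule insert.IH)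
    show "w \<in> carrier (free_module R S)"
      using c insert.hyps unfolding w_def by (auto simp: free_module_carrier)
    show "(\<lambda>j. w i \<otimes> unit_vec R i j) \<in> N" if "i \<in> S" for i
      using insert.prems(2)[of i] that insert.hyps(2) unfolding w_def by auto
  qed
  then have "(\<lambda>j. w j \<oplus> v s \<otimes> unit_vec R s j) \<in> N"
    using assms(4) insert.prems(2)[of s] by simp
  moreover have "(\<lambda>j. w j \<oplus> v s \<otimes> unit_vec R s j) = v"
    using c unfolding w_def unit_vec_def by auto
  ultimately show ?case by simp
qed

text \<open>Assuming only that the images of the basis vectors lift, rather than that \<open>g\<close> is surjective, lets
the same lemma serve for projectivity and for the quasi-sections below.\<close>
lemma free_module_lift:
  assumes "finite S" "module R N" "module R N'" "g \<in> lin_hom R N N'" "h \<in> lin_hom R (free_module R S) N'"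
    and "\<And>i. i \<in> S \<Longrightarrow> h (unit_vec R i) \<in> g ` carrier N"
  shows "\<exists>k\<in>lin_hom R (free_module R S) N. \<forall>v\<in>carrier (free_module R S). g (k v) = h v"
  using assms(1,5,6)
proof (induction S rule: finite_induct)
  case empty
  interpret N: module R N by fact
  have "(\<lambda>v. \<zero>\<^bsub>N\<^esub>) \<in> lin_hom R (free_module R {}) N"
    by (rule lin_homI) auto
  moreover have "g \<zero>\<^bsub>N\<^esub> = h v" if "v \<in> carrier (free_module R {})" for v
  proof -
    have "v = \<zero>\<^bsub>free_module R {}\<^esub>" using that by (auto simp: free_module_carrier)
    then show ?thesis
      using lin_hom_zero[OF assms(2,3,4)] lin_hom_zero[OF free_module_module assms(3) empty(1)]
      by simp
  qed
  ultimately show ?case by (intro bexI ballI)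
next
  case (insert s S)
  interpret N: module R N by fact
  interpret N': module R N' by fact
  let ?F = "free_module R S" and ?F' = "free_module R (insert s S)"
  have fin: "finite (insert s S)" using insert.hyps by simp
  have sub: "v \<in> carrier ?F'" if "v \<in> carrier ?F" for v
    using that insert.hyps(1) by (auto simp: free_module_carrier)
  have "h \<in> lin_hom R ?F N'"
    using insert.prems(1) sub unfolding lin_hom_def by (auto simp: Pi_iff)
  then have "\<exists>k\<in>lin_hom R ?F N. \<forall>v\<in>carrier ?F. g (k v) = h v"
    by (rule insert.IH) (rule insert.prems(2), simp)
  then obtain k where k: "k \<in> lin_hom R ?F N" "\<And>v. v \<in> carrier ?F \<Longrightarrow> g (k v) = h v"
    by blast
  obtain t where t: "t \<in> carrier N" "h (unit_vec R s) = g t"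
    using insert.prems(2)[of s] by auto
  have r: "v(s := \<zero>) \<in> carrier ?F" if "v \<in> carrier ?F'" for v
    using that insert.hyps by (auto simp: free_module_carrier)
  define k' where "k' v = k (v(s := \<zero>)) \<oplus>\<^bsub>N\<^esub> v s \<odot>\<^bsub>N\<^esub> t" for v
  have "k' \<in> lin_hom R ?F' N"
  proof (rule lin_homI)
    fix v assume v: "v \<in> carrier ?F'"
    have c: "v s \<in> carrier R" "k (v(s := \<zero>)) \<in> carrier N"
      using free_module_closed[OF v] lin_hom_closed[OF k(1) r[OF v]] by auto
    show "k' v \<in> carrier N" unfolding k'_def using c t by simp
    {
      fix a assume a: "a \<in> carrier R"
      have "(a \<odot>\<^bsub>?F'\<^esub> v)(s := \<zero>) = a \<odot>\<^bsub>?F\<^esub> (v(s := \<zero>))" using a by auto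
      then have "k ((a \<odot>\<^bsub>?F'\<^esub> v)(s := \<zero>)) = a \<odot>\<^bsub>N\<^esub> k (v(s := \<zero>))"
        using lin_hom_smult[OF k(1) a r[OF v]] by simp
      then show "k' (a \<odot>\<^bsub>?F'\<^esub> v) = a \<odot>\<^bsub>N\<^esub> k' v"
        unfolding k'_def using a c t by (simp add: N.smult_r_distr N.smult_assoc1)
    }
    fix w assume w: "w \<in> carrier ?F'"
    have cw: "w s \<in> carrier R" "k (w(s := \<zero>)) \<in> carrier N"
      using free_module_closed[OF w] lin_hom_closed[OF k(1) r[OF w]] by auto
    have "(v \<oplus>\<^bsub>?F'\<^esub> w)(s := \<zero>) = v(s := \<zero>) \<oplus>\<^bsub>?F\<^esub> w(s := \<zero>)" by auto
    then have "k ((v \<oplus>\<^bsub>?F'\<^esub> w)(s := \<zero>)) = k (v(s := \<zero>)) \<oplus>\<^bsub>N\<^esub> k (w(s := \<zero>))"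
      using lin_hom_add[OF k(1) r[OF v] r[OF w]] by simp
    then show "k' (v \<oplus>\<^bsub>?F'\<^esub> w) = k' v \<oplus>\<^bsub>N\<^esub> k' w"
      unfolding k'_def using c cw t by (simp add: N.smult_l_distr N.a_ac)
  qed
  moreover have "g (k' v) = h v" if v: "v \<in> carrier ?F'" for v
  proof -
    have c: "v s \<in> carrier R" "k (v(s := \<zero>)) \<in> carrier N"
      using free_module_closed[OF v] lin_hom_closed[OF k(1) r[OF v]] by auto
    have e: "unit_vec R s \<in> carrier ?F'" using unit_vec_carrier[OF fin] by simp
    have se: "v s \<odot>\<^bsub>?F'\<^esub> unit_vec R s \<in> carrier ?F'"
      using e c(1) fin by (auto simp: free_module_carrier)
    have "g (k' v) = h (v(s := \<zero>)) \<oplus>\<^bsub>N'\<^esub> v s \<odot>\<^bsub>N'\<^esub> h (unit_vec R s)"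
      unfolding k'_def using lin_hom_add[OF assms(4)] lin_hom_smult[OF assms(4)] c t k(2)[OF r[OF v]]
      by simp
    also have "\<dots> = h (v(s := \<zero>) \<oplus>\<^bsub>?F'\<^esub> v s \<odot>\<^bsub>?F'\<^esub> unit_vec R s)"
      using lin_hom_add[OF insert.prems(1) sub[OF r[OF v]] se] lin_hom_smult[OF insert.prems(1) c(1) e]
      by (simp add: fun_upd_def)
    also have "v(s := \<zero>) \<oplus>\<^bsub>?F'\<^esub> v s \<odot>\<^bsub>?F'\<^esub> unit_vec R s = v"
      using free_module_closed[OF v] unfolding unit_vec_def by auto
    finally show ?thesis .
  qed
  ultimately show ?case by blast
qed

end

section \<open>Ascending chains of submodules\<close>

definition acc_module :: "('a, 'r) ring_scheme \<Rightarrow> ('a, 'm, 'c) module_scheme \<Rightarrow> bool" where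
  "acc_module R M \<longleftrightarrow> (\<forall>N :: nat \<Rightarrow> 'm set. (\<forall>k. submodule (N k) R M) \<longrightarrow> (\<forall>k. N k \<subseteq> N (Suc k)) \<longrightarrow>
     (\<exists>n. \<forall>k\<ge>n. N k = N n))"

text \<open>A chain in \<open>R\<^bsup>S \<union> {s}\<^esup>\<close> is controlled by the ideals of its \<open>s\<close>-th coordinates and by its intersections
with \<open>R\<^bsup>S\<^esup>\<close>; both stabilise, and then so does the chain.\<close>
lemma (in cring) free_module_acc:
  fixes S :: "'i set"
  assumes "noetherian_ring R" "finite S"
  shows "acc_module R (free_module R S)"
  using assms(2)
proof (induction S rule: finite_induct)
  case empty
  interpret F: module R "free_module R {}" by (rule free_module_module) simp
  have triv: "N = {\<zero>\<^bsub>free_module R {}\<^esub>}" if "submodule N R (free_module R {})" for N :: "('i \<Rightarrow> 'a) set"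
  proof -
    have "v = \<zero>\<^bsub>free_module R {}\<^esub>" if "v \<in> N" for v
    proof
      fix i
      have "v \<in> carrier (free_module R {})" using F.submoduleE(1)[OF \<open>submodule N R _\<close>] that by blast
      from free_module_outside[OF this, of i] show "v i = \<zero>\<^bsub>free_module R {}\<^esub> i" by simp
    qed
    then show ?thesis using F.submoduleE(2)[OF that] by blast
  qed
  show ?case unfolding acc_module_def
  proof (intro allI impI exI)
    fix N :: "nat \<Rightarrow> ('i \<Rightarrow> 'a) set" and k
    assume "\<forall>k. submodule (N k) R (free_module R {})"
    then show "N k = N 0" using triv[of "N k"] triv[of "N 0"] by simp
  qed
next
  case (insert s S)
  interpret noetherian_ring R by fact
  let ?F = "free_module R S" and ?F' = "free_module R (insert s S)"
  have fin: "finite (insert s S)" using insert.hyps by simp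
  interpret F: module R ?F by (rule free_module_module) fact
  interpret F': module R ?F' by (rule free_module_module) fact
  show ?case
    unfolding acc_module_def
  proof (intro allI impI)
    fix N :: "nat \<Rightarrow> ('i \<Rightarrow> 'a) set"
    assume N: "\<forall>k. submodule (N k) R ?F'" and "\<forall>k. N k \<subseteq> N (Suc k)"
    then have mono: "N k \<subseteq> N (Suc k)" for k by simp
    have Nc: "N k \<subseteq> carrier ?F'" for k using F'.submoduleE(1)[OF N[rule_format]] .
    note Na = F'.submoduleE(5)[OF N[rule_format], unfolded free_module_simps]
      and Ns = F'.submoduleE(4)[OF N[rule_format], unfolded free_module_simps]
    have Nz: "(\<lambda>i. \<zero>) \<in> N k" for k
      using subgroup.one_closed[OF submodule.axioms(1)[OF N[rule_format, of k]]] by simp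
    have Nv: "v i \<in> carrier R" if "v \<in> N k" for v i k
      using free_module_closed[OF subsetD[OF Nc that]] .
    define I where "I k = (\<lambda>v. v s) ` N k" for k
    have I: "ideal (I k) R" for k
    proof (rule idealI[OF ring_axioms])
      show "subgroup (I k) (add_monoid R)"
      proof (rule add.subgroupI)
        show "I k \<subseteq> carrier R" "I k \<noteq> {}" unfolding I_def using Nv Nz[of k] by auto
        fix a assume "a \<in> I k"
        then obtain v where v: "v \<in> N k" "a = v s" unfolding I_def by auto
        have "(\<lambda>i. (\<ominus> \<one>) \<otimes> v i) \<in> N k" using Ns[OF _ v(1)] by simp
        moreover have "(\<ominus> \<one>) \<otimes> v s = \<ominus> a" using v Nv[OF v(1)] by (simp add: l_minus)
        ultimately show "\<ominus> a \<in> I k"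
          unfolding I_def by (intro image_eqI) simp_all
      next
        fix a b assume "a \<in> I k" "b \<in> I k"
        then obtain v w where "v \<in> N k" "w \<in> N k" "a = v s" "b = w s" unfolding I_def by auto
        then have "(\<lambda>i. v i \<oplus> w i) \<in> N k" "a \<oplus> b = (\<lambda>i. v i \<oplus> w i) s" using Na by auto
        then show "a \<oplus> b \<in> I k" 
          unfolding I_def by (intro image_eqI) simp_all
      qed
      fix a x assume "a \<in> I k" and x: "x \<in> carrier R"
      then obtain v where v: "v \<in> N k" "a = v s" unfolding I_def by auto
      have "(\<lambda>i. x \<otimes> v i) \<in> N k" using Ns[OF x v(1)] by simp
      then show "x \<otimes> a \<in> I k" 
        unfolding I_def v(2) by (intro image_eqI) simp_all
      then show "a \<otimes> x \<in> I k" using m_comm[OF x] Nv[OF v(1)] v(2) by simp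
    qed
    have "I k \<subseteq> I (Suc k)" for k unfolding I_def using mono by blast
    from ideal_acc[of I, OF I this] obtain n1 where n1: "\<And>k. k \<ge> n1 \<Longrightarrow> I k = I n1" by blast
    define L where "L k = N k \<inter> carrier ?F" for k
    have L: "submodule (L k) R ?F" for k
      by (rule F.submoduleI')
        (use Na Ns Nz in \<open>auto simp: L_def free_module_carrier[OF insert.hyps(1)]\<close>)
    have "L k \<subseteq> L (Suc k)" for k unfolding L_def using mono by blast
    then obtain n2 where n2: "\<And>k. k \<ge> n2 \<Longrightarrow> L k = L n2"
      using insert.IH[unfolded acc_module_def, rule_format, of L] L by blast
    define n where "n = max n1 n2"
    have "N k = N n" if k: "k \<ge> n" for k
    proof
      show "N n \<subseteq> N k" using lift_Suc_mono_le[of N, OF mono k] .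
      show "N k \<subseteq> N n"
      proof
        fix v assume v: "v \<in> N k"
        then have "v s \<in> I n" using n1[of k] n1[of n] k unfolding n_def I_def by auto
        then obtain w where w: "w \<in> N n" "w s = v s" unfolding I_def by auto
        have wk: "w \<in> N k" using lift_Suc_mono_le[of N, OF mono k] w(1) by blast
        define u where "u = (\<lambda>i. v i \<oplus> (\<ominus> \<one>) \<otimes> w i)"
        have uk: "u \<in> N k" unfolding u_def using Na[OF v] Ns[OF _ wk] by simp
        have us: "u i = v i \<ominus> w i" for i
          unfolding u_def using Nv[OF v] Nv[OF wk] by (simp add: l_minus a_minus_def)
        have "u s = \<zero>" using us[of s] w(2) Nv[OF v] by (simp add: a_minus_def r_neg)
        then have "u \<in> carrier ?F"
          using subsetD[OF Nc uk] insert.hyps(1) by (auto simp: free_module_carrier)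
        then have "u \<in> L k" using uk unfolding L_def by simp
        then have "u \<in> L n" using n2[of k] n2[of n] k unfolding n_def by auto
        then have un: "u \<in> N n" unfolding L_def by simp
        have "v = (\<lambda>i. u i \<oplus> w i)"
        proof
          fix i
          have "v i \<in> carrier R" "w i \<in> carrier R" using Nv v wk by auto
          then show "v i = u i \<oplus> w i" unfolding us by algebra
        qed
        then show "v \<in> N n" using Na[OF un w(1)] by simp
      qed
    qed
    then show "\<exists>n. \<forall>k\<ge>n. N k = N n" by blast
  qed
qed

text \<open>A surjective endomorphism of a noetherian module is injective; here modulo a stable submodule \<open>N\<close>
and up to powers of \<open>a\<close>. The chain of the preimages of \<open>N\<close> under \<open>A\<^sup>k\<close> stabilises at some \<open>n\<close>.
Writing \<open>a\<^sup>n u = A\<^sup>n z + w\<close> with \<open>w \<in> N\<close>, the hypothesis \<open>A u \<in> N\<close> puts \<open>z\<close> into the preimage for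
\<open>n + 1\<close>, hence into the one for \<open>n\<close>.\<close>
lemma (in module) acc_endo_torsion:
  assumes acc: "acc_module R M" and A: "A \<in> lin_hom R M M"
    and N: "submodule N R M" and AN: "\<And>v. v \<in> N \<Longrightarrow> A v \<in> N"
    and a: "a \<in> carrier R"
    and im: "\<And>u. u \<in> carrier M \<Longrightarrow> \<exists>v\<in>carrier M. \<exists>w\<in>N. a \<odot>\<^bsub>M\<^esub> u = A v \<oplus>\<^bsub>M\<^esub> w"
    and u: "u \<in> carrier M" "A u \<in> N"
  shows "\<exists>n::nat. (a [^]\<^bsub>R\<^esub> n) \<odot>\<^bsub>M\<^esub> u \<in> N"
proof -
  have Nc: "v \<in> carrier M" if "v \<in> N" for v using submoduleE(1)[OF N] that by blast
  note Ns = submoduleE(4)[OF N] and Na = submoduleE(5)[OF N]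
  have Nz: "\<zero>\<^bsub>M\<^esub> \<in> N"
    using subgroup.one_closed[OF submodule.axioms(1)[OF N]] by simp
  have Ak: "(A ^^ k) v \<in> carrier M" if "v \<in> carrier M" for k v
    using lin_hom_closed[OF A] that by (induction k) auto
  have Ak_add: "(A ^^ k) (v \<oplus>\<^bsub>M\<^esub> w) = (A ^^ k) v \<oplus>\<^bsub>M\<^esub> (A ^^ k) w"
    if "v \<in> carrier M" "w \<in> carrier M" for k v w
    using lin_hom_add[OF A] Ak that by (induction k) auto
  have Ak_smult: "(A ^^ k) (b \<odot>\<^bsub>M\<^esub> v) = b \<odot>\<^bsub>M\<^esub> (A ^^ k) v"
    if "v \<in> carrier M" "b \<in> carrier R" for k v b
    using lin_hom_smult[OF A] Ak that by (induction k) auto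
  have AkN: "(A ^^ k) v \<in> N" if "v \<in> N" for k v
    using that AN by (induction k) auto
  have Asw: "(A ^^ Suc k) v = (A ^^ k) (A v)" for k v by (simp add: funpow_swap1)
  define U where "U k = {v \<in> carrier M. (A ^^ k) v \<in> N}" for k
  have "submodule (U k) R M" for k
  proof (rule submoduleI')
    show "\<zero>\<^bsub>M\<^esub> \<in> U k" unfolding U_def using AkN[OF Nz] by simp
  qed (auto simp: U_def Ak_add Ak_smult Ns Na)
  moreover have "U k \<subseteq> U (Suc k)" for k unfolding U_def using AN by auto
  ultimately obtain n where n: "\<And>k. k \<ge> n \<Longrightarrow> U k = U n"
    using acc[unfolded acc_module_def, rule_format, of U] by blast
  have pw: "\<exists>z\<in>carrier M. \<exists>w\<in>N. (a [^]\<^bsub>R\<^esub> k) \<odot>\<^bsub>M\<^esub> u = (A ^^ k) z \<oplus>\<^bsub>M\<^esub> w" for k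
  proof (induction k)
    case 0
    show ?case using u Nz by (intro bexI[of _ u] bexI[of _ "\<zero>\<^bsub>M\<^esub>"]) auto
  next
    case (Suc k)
    then obtain z w where zw: "z \<in> carrier M" "w \<in> N" "(a [^]\<^bsub>R\<^esub> k) \<odot>\<^bsub>M\<^esub> u = (A ^^ k) z \<oplus>\<^bsub>M\<^esub> w"
      by blast
    obtain z' w' where zw': "z' \<in> carrier M" "w' \<in> N" "a \<odot>\<^bsub>M\<^esub> z = A z' \<oplus>\<^bsub>M\<^esub> w'"
      using im[OF zw(1)] by blast
    have "(a [^]\<^bsub>R\<^esub> Suc k) \<odot>\<^bsub>M\<^esub> u = a \<odot>\<^bsub>M\<^esub> ((a [^]\<^bsub>R\<^esub> k) \<odot>\<^bsub>M\<^esub> u)"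
      using a u smult_assoc1[of a "a [^]\<^bsub>R\<^esub> k" u] by (simp add: R.m_comm)
    also have "\<dots> = (A ^^ k) (a \<odot>\<^bsub>M\<^esub> z) \<oplus>\<^bsub>M\<^esub> a \<odot>\<^bsub>M\<^esub> w"
      unfolding zw(3) using zw a Nc Ak by (simp add: smult_r_distr Ak_smult)
    also have "\<dots> = (A ^^ Suc k) z' \<oplus>\<^bsub>M\<^esub> ((A ^^ k) w' \<oplus>\<^bsub>M\<^esub> a \<odot>\<^bsub>M\<^esub> w)"
      unfolding zw'(3) Asw using zw zw' a Nc Ak lin_hom_closed[OF A]
      by (simp add: Ak_add M.a_assoc)
    finally show ?case using zw zw' Na[OF AkN[OF zw'(2)] Ns[OF a zw(2)]] by blast
  qed
  obtain z w where zw: "z \<in> carrier M" "w \<in> N" "(a [^]\<^bsub>R\<^esub> n) \<odot>\<^bsub>M\<^esub> u = (A ^^ n) z \<oplus>\<^bsub>M\<^esub> w"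
    using pw[of n] by blast
  have "A ((a [^]\<^bsub>R\<^esub> n) \<odot>\<^bsub>M\<^esub> u) \<in> N" using lin_hom_smult[OF A] Ns u a by simp
  then have "A ((A ^^ n) z) \<oplus>\<^bsub>M\<^esub> A w \<in> N"
    unfolding zw(3) using lin_hom_add[OF A] Ak zw Nc by simp
  then have "(A ((A ^^ n) z) \<oplus>\<^bsub>M\<^esub> A w) \<oplus>\<^bsub>M\<^esub> \<ominus>\<^bsub>M\<^esub> A w \<in> N"
    using Na submoduleE(3)[OF N] AN[OF zw(2)] by blast
  moreover have "(A ((A ^^ n) z) \<oplus>\<^bsub>M\<^esub> A w) \<oplus>\<^bsub>M\<^esub> \<ominus>\<^bsub>M\<^esub> A w = A ((A ^^ n) z)"
    using lin_hom_closed[OF A] Ak[OF zw(1)] Nc[OF zw(2)] by (simp add: M.a_assoc M.r_neg)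
  ultimately have "z \<in> U (Suc n)" unfolding U_def using zw by simp
  then have "z \<in> U n" using n[of "Suc n"] by simp
  then have "(a [^]\<^bsub>R\<^esub> n) \<odot>\<^bsub>M\<^esub> u \<in> N" unfolding zw(3) U_def using Na zw by simp
  then show ?thesis by blast
qed

section \<open>Presentations up to powers of an element\<close>

context cring
begin

abbreviation free_n :: "nat \<Rightarrow> ('a, nat \<Rightarrow> 'a) module" where
  "free_n n \<equiv> free_module R {..<n}"

lemma free_n_carrier: "v \<in> carrier (free_n n) \<longleftrightarrow> (\<forall>i. v i \<in> carrier R) \<and> (\<forall>i\<ge>n. v i = \<zero>)"
  by (auto simp: free_module_carrier)

lemma free_n_le: "v \<in> carrier (free_n p) \<Longrightarrow> p \<le> q \<Longrightarrow> v \<in> carrier (free_n q)"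
  by (auto simp: free_n_carrier)

lemma lin_hom_restrict:
  assumes "E \<in> lin_hom R (free_n p) (free_n q)" "p \<le> q"
  shows "(\<lambda>v. E (\<lambda>i. if i < p then v i else \<zero>)) \<in> lin_hom R (free_n q) (free_n q)"
proof (rule lin_hom_comp[OF _ assms(1)], rule lin_homI)
  fix v w a assume "v \<in> carrier (free_n q)" "w \<in> carrier (free_n q)" 
  then show "(\<lambda>i. if i < p then (v \<oplus>\<^bsub>free_n q\<^esub> w) i else \<zero>) =
    (\<lambda>i. if i < p then v i else \<zero>) \<oplus>\<^bsub>free_n p\<^esub> (\<lambda>i. if i < p then w i else \<zero>)" by auto
qed (auto simp: free_n_carrier)

text \<open>Invariance of the rank. Composed with the projection \<open>R\<^sup>q \<rightarrow> R\<^sup>p\<close>, the map \<open>E\<close> becomes an endomorphism of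
\<open>R\<^sup>q\<close> that is surjective up to \<open>a\<close> and kills a basis vector.\<close>
lemma rank_lt_imp_nilpotent:
  assumes noeth: "noetherian_ring R"
    and E: "E \<in> lin_hom R (free_n p) (free_n q)" and a: "a \<in> carrier R" and pq: "p < q"
    and im: "\<And>u. u \<in> carrier (free_n q) \<Longrightarrow> \<exists>v\<in>carrier (free_n p). a \<odot>\<^bsub>free_n q\<^esub> u = E v"
  shows "\<exists>n::nat. a [^] n = \<zero>"
proof -
  interpret F: module R "free_n q" by (rule free_module_module) simp
  define A where "A = (\<lambda>v. E (\<lambda>i. if i < p then v i else \<zero>))"
  have A: "A \<in> lin_hom R (free_n q) (free_n q)"
    unfolding A_def using lin_hom_restrict[OF E] pq by simp
  have z: "submodule {\<zero>\<^bsub>free_n q\<^esub>} R (free_n q)"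
    by (rule F.submoduleI') (auto simp: free_n_carrier)
  have "unit_vec R p \<in> carrier (free_n q)" using pq by (auto intro: unit_vec_carrier)
  moreover have "A (unit_vec R p) = \<zero>\<^bsub>free_n q\<^esub>"
  proof -
    have "(\<lambda>i. if i < p then unit_vec R p i else \<zero>) = \<zero>\<^bsub>free_n p\<^esub>"
      unfolding unit_vec_def by auto
    then show ?thesis
      unfolding A_def using lin_hom_zero[OF free_module_module free_module_module E] by simp
  qed
  moreover have "\<exists>v\<in>carrier (free_n q). \<exists>w\<in>{\<zero>\<^bsub>free_n q\<^esub>}. a \<odot>\<^bsub>free_n q\<^esub> u = A v \<oplus>\<^bsub>free_n q\<^esub> w"
    if u: "u \<in> carrier (free_n q)" for u
  proof -
    obtain v where v: "v \<in> carrier (free_n p)" "a \<odot>\<^bsub>free_n q\<^esub> u = E v" using im[OF u] by blast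
    have "(\<lambda>i. if i < p then v i else \<zero>) = v" using v(1) by (auto simp: free_n_carrier)
    then have "A v = E v" unfolding A_def by simp
    moreover have "E v \<in> carrier (free_n q)" using lin_hom_closed[OF E v(1)] .
    ultimately show ?thesis
      unfolding v(2) using free_n_le[OF v(1)] pq F.M.r_zero[of "E v"]
      by (intro bexI[of _ v] bexI[of _ "\<zero>\<^bsub>free_n q\<^esub>"]) (simp_all del: free_module_simps)
  qed
  ultimately have "\<exists>n::nat. (a [^] n) \<odot>\<^bsub>free_n q\<^esub> unit_vec R p \<in> {\<zero>\<^bsub>free_n q\<^esub>}"
    using lin_hom_zero[OF F.module_axioms F.module_axioms A]
    by (intro F.acc_endo_torsion[OF free_module_acc[OF noeth finite_lessThan] A z _ a]) blast+
  then obtain n :: nat where "(a [^] n) \<odot>\<^bsub>free_n q\<^esub> unit_vec R p \<in> {\<zero>\<^bsub>free_n q\<^esub>}" by blast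
  then have "(a [^] n) \<otimes> unit_vec R p p = \<zero>" by (simp add: fun_eq_iff)
  then show ?thesis using a unfolding unit_vec_def by auto
qed

text \<open>After inverting \<open>x\<close>, the sequence \<open>0 \<rightarrow> K \<rightarrow> R\<^sup>q \<rightarrow> R\<^sup>p \<rightarrow> 0\<close> with second map \<open>D\<close> becomes exact. Since all
vectors are functions on \<open>nat\<close>, a submodule \<open>K\<close> of a smaller \<open>R\<^sup>b\<close> is literally a subset of \<open>R\<^sup>q\<close>.\<close>
definition presents_upto :: "'a \<Rightarrow> (nat \<Rightarrow> 'a) set \<Rightarrow> nat \<Rightarrow> nat \<Rightarrow> ((nat \<Rightarrow> 'a) \<Rightarrow> nat \<Rightarrow> 'a) \<Rightarrow> bool" where
  "presents_upto x K q p D \<longleftrightarrow> D \<in> lin_hom R (free_n q) (free_n p) \<and> K \<subseteq> lin_ker (free_n q) (free_n p) D \<and>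
     (\<exists>c::nat. \<forall>u\<in>carrier (free_n p). \<exists>v\<in>carrier (free_n q). (\<lambda>i. x [^] c \<otimes> u i) = D v) \<and>
     (\<exists>c::nat. \<forall>v\<in>lin_ker (free_n q) (free_n p) D. (\<lambda>i. x [^] c \<otimes> v i) \<in> K)"

text \<open>\<open>D\<close> has a section up to the factor \<open>a\<close>, because its target is free.\<close>
lemma quasi_section:
  assumes D: "D \<in> lin_hom R (free_n q) (free_n p)" and a: "a \<in> carrier R"
    and im: "\<forall>u\<in>carrier (free_n p). \<exists>v\<in>carrier (free_n q). (\<lambda>i. a \<otimes> u i) = D v"
  obtains E where "E \<in> lin_hom R (free_n p) (free_n q)"
    "\<And>u. u \<in> carrier (free_n p) \<Longrightarrow> D (E u) = (\<lambda>i. a \<otimes> u i)"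
proof -
  interpret P: module R "free_n p" by (rule free_module_module) simp
  have h: "(\<lambda>u. a \<odot>\<^bsub>free_n p\<^esub> u) \<in> lin_hom R (free_n p) (free_n p)"
  proof (rule lin_homI)
    fix x y assume xy: "x \<in> carrier (free_n p)" "y \<in> carrier (free_n p)"
    show "a \<odot>\<^bsub>free_n p\<^esub> x \<in> carrier (free_n p)" using P.smult_closed[OF a xy(1)] .
    show "a \<odot>\<^bsub>free_n p\<^esub> (x \<oplus>\<^bsub>free_n p\<^esub> y) = a \<odot>\<^bsub>free_n p\<^esub> x \<oplus>\<^bsub>free_n p\<^esub> a \<odot>\<^bsub>free_n p\<^esub> y"
      using P.smult_r_distr[OF a xy] .
    fix r assume r: "r \<in> carrier R"
    show "a \<odot>\<^bsub>free_n p\<^esub> (r \<odot>\<^bsub>free_n p\<^esub> x) = r \<odot>\<^bsub>free_n p\<^esub> (a \<odot>\<^bsub>free_n p\<^esub> x)"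
      using P.smult_assoc1[OF a r xy(1)] P.smult_assoc1[OF r a xy(1)] m_comm[OF a r] by metis
  qed
  have "\<exists>k\<in>lin_hom R (free_n p) (free_n q). \<forall>v\<in>carrier (free_n p). D (k v) = a \<odot>\<^bsub>free_n p\<^esub> v"
  proof (rule free_module_lift[OF _ free_module_module free_module_module D h])
    fix i assume "i \<in> {..<p}"
    then have "unit_vec R i \<in> carrier (free_n p)" by (intro unit_vec_carrier) auto
    then show "a \<odot>\<^bsub>free_n p\<^esub> unit_vec R i \<in> D ` carrier (free_n q)" using im by auto
  qed auto
  then show thesis using that by auto
qed

lemma quasi_section_defect:
  assumes D: "D \<in> lin_hom R (free_n q) (free_n p)" and E: "E \<in> lin_hom R (free_n p) (free_n q)"
    and DE: "\<And>u. u \<in> carrier (free_n p) \<Longrightarrow> D (E u) = (\<lambda>i. a \<otimes> u i)"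
    and a: "a \<in> carrier R" and u: "u \<in> carrier (free_n q)"
  shows "(\<lambda>i. a \<otimes> u i \<oplus> (\<ominus> \<one>) \<otimes> E (D u) i) \<in> lin_ker (free_n q) (free_n p) D"
proof -
  interpret Q: module R "free_n q" by (rule free_module_module) simp
  have Du: "D u \<in> carrier (free_n p)" using lin_hom_closed[OF D u] .
  have EDu: "E (D u) \<in> carrier (free_n q)" using lin_hom_closed[OF E Du] .
  have Dui: "D u i \<in> carrier R" for i using free_module_closed[OF Du] .
  have m1: "\<ominus> \<one> \<in> carrier R" by simp
  let ?y = "a \<odot>\<^bsub>free_n q\<^esub> u \<oplus>\<^bsub>free_n q\<^esub> (\<ominus> \<one>) \<odot>\<^bsub>free_n q\<^esub> E (D u)"
  note yc = Q.smult_closed[OF a u] Q.smult_closed[OF m1 EDu]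
  have "D ?y = a \<odot>\<^bsub>free_n p\<^esub> D u \<oplus>\<^bsub>free_n p\<^esub> (\<ominus> \<one>) \<odot>\<^bsub>free_n p\<^esub> D (E (D u))"
    unfolding lin_hom_add[OF D yc] lin_hom_smult[OF D a u] lin_hom_smult[OF D m1 EDu] ..
  also have "\<dots> = \<zero>\<^bsub>free_n p\<^esub>"
    unfolding DE[OF Du] using Dui a by (auto simp: l_minus r_neg)
  finally have "?y \<in> lin_ker (free_n q) (free_n p) D"
    unfolding lin_ker_def using Q.M.a_closed[OF yc] by blast
  then show ?thesis by simp
qed

text \<open>Passage to the next syzygy module. If \<open>E\<close> is a section of \<open>D\<close> up to a power of \<open>x\<close>, then \<open>R\<^sup>q\<close> is up
to powers of \<open>x\<close> the sum of \<open>K = f (R\<^sup>b)\<close> and \<open>E (R\<^sup>p)\<close>; so \<open>(v, w) \<mapsto> f v + E w\<close> is surjective with kernel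
that of \<open>f\<close>, again up to powers of \<open>x\<close>. The new ranks do not depend on \<open>x\<close>.\<close>
lemma presents_upto_step:
  assumes K: "presents_upto x K q p D" and x: "x \<in> carrier R"
    and f: "f \<in> lin_hom R (free_n b) (free_n b')" "f ` carrier (free_n b) = K"
  shows "\<exists>D'. presents_upto x (lin_ker (free_n b) (free_n b') f) (b + p) q D'"
proof -
  interpret P: module R "free_n p" by (rule free_module_module) simp
  interpret Q: module R "free_n q" by (rule free_module_module) simp
  obtain c k where D: "D \<in> lin_hom R (free_n q) (free_n p)" "K \<subseteq> lin_ker (free_n q) (free_n p) D"
     "\<forall>u\<in>carrier (free_n p). \<exists>v\<in>carrier (free_n q). (\<lambda>i. x [^] (c::nat) \<otimes> u i) = D v"
     "\<And>v. v \<in> lin_ker (free_n q) (free_n p) D \<Longrightarrow> (\<lambda>i. x [^] (k::nat) \<otimes> v i) \<in> K"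
    using K unfolding presents_upto_def by blast
  have xc: "x [^] n \<in> carrier R" for n :: nat using x by simp
  obtain E where E: "E \<in> lin_hom R (free_n p) (free_n q)"
    "\<And>u. u \<in> carrier (free_n p) \<Longrightarrow> D (E u) = (\<lambda>i. x [^] c \<otimes> u i)"
    using quasi_section[OF D(1) xc D(3)] by metis
  have fK: "f v \<in> carrier (free_n q)" "D (f v) = \<zero>\<^bsub>free_n p\<^esub>" if "v \<in> carrier (free_n b)" for v
    using f(2) D(2) that unfolding lin_ker_def by auto
  have f': "f \<in> lin_hom R (free_n b) (free_n q)"
    using f(1) fK(1) unfolding lin_hom_def by auto
  \<comment> \<open>\<open>l\<close> and \<open>r\<close> project \<open>R\<^bsup>b + p\<^esup>\<close> to its summands \<open>R\<^sup>b\<close> and \<open>R\<^sup>p\<close>.\<close>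
  define l where "l v = (\<lambda>i. if i < b then v i else \<zero>)" for v :: "nat \<Rightarrow> 'a"
  define r where "r v = (\<lambda>i. v (i + b))" for v :: "nat \<Rightarrow> 'a"
  have l: "l \<in> lin_hom R (free_n (b + p)) (free_n b)"
    by (rule lin_homI) (auto simp: l_def free_n_carrier)
  have r: "r \<in> lin_hom R (free_n (b + p)) (free_n p)"
    by (rule lin_homI) (auto simp: r_def free_n_carrier)
  define D' where "D' v = f (l v) \<oplus>\<^bsub>free_n q\<^esub> E (r v)" for v
  have fl: "(\<lambda>v. f (l v)) \<in> lin_hom R (free_n (b + p)) (free_n q)" by (rule lin_hom_comp[OF l f'])
  have Er: "(\<lambda>v. E (r v)) \<in> lin_hom R (free_n (b + p)) (free_n q)" by (rule lin_hom_comp[OF r E(1)])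
  have D': "D' \<in> lin_hom R (free_n (b + p)) (free_n q)"
  proof (rule lin_homI)
    fix v w a assume v: "v \<in> carrier (free_n (b + p))" 
    note cv = lin_hom_closed[OF fl v] lin_hom_closed[OF Er v]
    show "D' v \<in> carrier (free_n q)" unfolding D'_def using cv Q.M.a_closed by blast
    show "D' (a \<odot>\<^bsub>free_n (b + p)\<^esub> v) = a \<odot>\<^bsub>free_n q\<^esub> D' v" if a: "a \<in> carrier R"
      unfolding D'_def lin_hom_smult[OF fl a v] lin_hom_smult[OF Er a v] Q.smult_r_distr[OF a cv] ..
    assume w: "w \<in> carrier (free_n (b + p))" 
    note cw = lin_hom_closed[OF fl w] lin_hom_closed[OF Er w]
    show "D' (v \<oplus>\<^bsub>free_n (b + p)\<^esub> w) = D' v \<oplus>\<^bsub>free_n q\<^esub> D' w"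
      unfolding D'_def lin_hom_add[OF fl v w] lin_hom_add[OF Er v w] 
      using cv cw Q.M.a_ac by (simp del: free_module_simps)
  qed
  have joinc: "(\<lambda>i. if i < b then v i else w (i - b)) \<in> carrier (free_n (b + p))"
    if "v \<in> carrier (free_n b)" "w \<in> carrier (free_n p)" for v w
    using that by (auto simp: free_n_carrier)
  have joinD: "D' (\<lambda>i. if i < b then v i else w (i - b)) = f v \<oplus>\<^bsub>free_n q\<^esub> E w"
    if "v \<in> carrier (free_n b)" "w \<in> carrier (free_n p)" for v w
  proof -
    have "l (\<lambda>i. if i < b then v i else w (i - b)) = v"
      using that(1) unfolding l_def by (auto simp: free_n_carrier)
    moreover have "r (\<lambda>i. if i < b then v i else w (i - b)) = w" unfolding r_def by auto
    ultimately show ?thesis unfolding D'_def by simp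
  qed
  have surj: "\<exists>v\<in>carrier (free_n (b + p)). (\<lambda>i. x [^] (k + c) \<otimes> u i) = D' v"
    if u: "u \<in> carrier (free_n q)" for u
  proof -
    have Du: "D u \<in> carrier (free_n p)" using lin_hom_closed[OF D(1) u] .
    have Dui: "D u i \<in> carrier R" "u i \<in> carrier R" "E (D u) i \<in> carrier R" for i
      using Du u lin_hom_closed[OF E(1) Du] free_module_closed by metis+
    have "(\<lambda>i. x [^] c \<otimes> u i \<oplus> (\<ominus> \<one>) \<otimes> E (D u) i) \<in> lin_ker (free_n q) (free_n p) D"
      by (rule quasi_section_defect[OF D(1) E(1) _ xc u]) (rule E(2))
    from D(4)[OF this] obtain v where v: "v \<in> carrier (free_n b)" "(\<lambda>i. x [^] k \<otimes> (x [^] c \<otimes> u i \<oplus> (\<ominus> \<one>) \<otimes> E (D u) i)) = f v"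
      using f(2) by auto
    let ?w = "(x [^] k) \<odot>\<^bsub>free_n p\<^esub> D u"
    have w: "?w \<in> carrier (free_n p)" using P.smult_closed[OF xc Du] .
    have "f v \<oplus>\<^bsub>free_n q\<^esub> E ?w = (\<lambda>i. x [^] (k + c) \<otimes> u i)"
    proof
      fix i
      have "(f v \<oplus>\<^bsub>free_n q\<^esub> E ?w) i = x [^] k \<otimes> (x [^] c \<otimes> u i \<oplus> (\<ominus> \<one>) \<otimes> E (D u) i) \<oplus> x [^] k \<otimes> E (D u) i"
        unfolding v(2)[symmetric] lin_hom_smult[OF E(1) xc Du] by simp
      also have "\<dots> = (x [^] k \<otimes> x [^] c) \<otimes> u i"
        using Dui[of i] xc[of k] xc[of c] by algebra
      also have "\<dots> = x [^] (k + c) \<otimes> u i" using nat_pow_mult[OF x] by simp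
      finally show "(f v \<oplus>\<^bsub>free_n q\<^esub> E ?w) i = x [^] (k + c) \<otimes> u i" .
    qed
    then show ?thesis using joinc[OF v(1) w] joinD[OF v(1) w] by metis
  qed
  have ker1: "lin_ker (free_n b) (free_n b') f \<subseteq> lin_ker (free_n (b + p)) (free_n q) D'"
  proof
    fix v assume v: "v \<in> lin_ker (free_n b) (free_n b') f"
    have vb: "v \<in> carrier (free_n b)" "f v = \<zero>\<^bsub>free_n q\<^esub>" using v unfolding lin_ker_def by auto
    have lr: "l v = v" "r v = \<zero>\<^bsub>free_n p\<^esub>"
      using vb(1) unfolding l_def r_def by (auto simp: free_n_carrier)
    have "D' v = \<zero>\<^bsub>free_n q\<^esub>"
      unfolding D'_def lr vb(2) lin_hom_zero[OF P.module_axioms Q.module_axioms E(1)]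
      using Q.M.r_zero Q.M.zero_closed by blast
    then show "v \<in> lin_ker (free_n (b + p)) (free_n q) D'"
      unfolding lin_ker_def using free_n_le[OF vb(1)] by auto
  qed
  have ker2: "(\<lambda>i. x [^] c \<otimes> v i) \<in> lin_ker (free_n b) (free_n b') f"
    if v: "v \<in> lin_ker (free_n (b + p)) (free_n q) D'" for v
  proof -
    have vc: "v \<in> carrier (free_n (b + p))" and D'v: "f (l v) \<oplus>\<^bsub>free_n q\<^esub> E (r v) = \<zero>\<^bsub>free_n q\<^esub>"
      using v unfolding lin_ker_def D'_def by auto
    note lv = lin_hom_closed[OF l vc] and rv = lin_hom_closed[OF r vc]
    have "D (f (l v)) \<oplus>\<^bsub>free_n p\<^esub> D (E (r v)) = \<zero>\<^bsub>free_n p\<^esub>"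
      using lin_hom_add[OF D(1) fK(1)[OF lv] lin_hom_closed[OF E(1) rv]] 
        lin_hom_zero[OF Q.module_axioms P.module_axioms D(1)] D'v by argo
    then have "D (E (r v)) = \<zero>\<^bsub>free_n p\<^esub>"
      unfolding fK(2)[OF lv] using P.M.l_zero lin_hom_closed[OF D(1) lin_hom_closed[OF E(1) rv]] by metis
    then have xr: "(x [^] c) \<odot>\<^bsub>free_n p\<^esub> r v = \<zero>\<^bsub>free_n p\<^esub>" unfolding E(2)[OF rv] by simp
    have "f ((x [^] c) \<odot>\<^bsub>free_n b\<^esub> l v) \<oplus>\<^bsub>free_n q\<^esub> E ((x [^] c) \<odot>\<^bsub>free_n p\<^esub> r v) = 
      (x [^] c) \<odot>\<^bsub>free_n q\<^esub> (f (l v) \<oplus>\<^bsub>free_n q\<^esub> E (r v))"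
      unfolding lin_hom_smult[OF f' xc lv] lin_hom_smult[OF E(1) xc rv]
        Q.smult_r_distr[OF xc fK(1)[OF lv] lin_hom_closed[OF E(1) rv]] ..
    also have "\<dots> = \<zero>\<^bsub>free_n q\<^esub>" unfolding D'v using Q.smult_r_null xc by blast
    finally have f0: "f ((x [^] c) \<odot>\<^bsub>free_n b\<^esub> l v) = \<zero>\<^bsub>free_n q\<^esub>"
      unfolding xr lin_hom_zero[OF P.module_axioms Q.module_axioms E(1)] 
      unfolding lin_hom_smult[OF f' xc lv]
      using Q.M.r_zero[OF Q.smult_closed[OF xc fK(1)[OF lv]]] by metis
    have "(\<lambda>i. x [^] c \<otimes> v i) = (x [^] c) \<odot>\<^bsub>free_n b\<^esub> l v"
    proof
      fix i
      show "x [^] c \<otimes> v i = ((x [^] c) \<odot>\<^bsub>free_n b\<^esub> l v) i"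
      proof (cases "i < b")
        case True then show ?thesis unfolding l_def by simp
      next
        case False
        then have "x [^] c \<otimes> v i = ((x [^] c) \<odot>\<^bsub>free_n p\<^esub> r v) (i - b)" unfolding r_def by simp
        also have "\<dots> = \<zero>" unfolding xr by simp
        finally show ?thesis using False xc unfolding l_def by simp
      qed
    qed
    moreover have "(x [^] c) \<odot>\<^bsub>free_n b\<^esub> l v \<in> carrier (free_n b)"
      using module.smult_closed[OF free_module_module xc lv] by simp
    ultimately show ?thesis using f0 unfolding lin_ker_def by simp
  qed
  show ?thesis
    unfolding presents_upto_def using D' surj ker1 ker2 by blast
qed

end

section \<open>Finite length and finite projective dimension\<close>

text \<open>A chain \<open>R v \<supset> R x v \<supset> \<dots>\<close> can only descend strictly as often as the length permits, and equality of two
neighbours \<open>R x\<^sup>k v = R x\<^bsup>k + 1\<^esup> v\<close> gives \<open>(1 - r x) x\<^sup>k v = 0\<close> with a unit \<open>1 - r x\<close>. The length bounds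
the exponent uniformly in \<open>v\<close>.\<close>
lemma (in noetherian_local_ring) finite_length_imp_killed:
  assumes "module R M" "module_length R M < \<infinity>" "x \<in> m"
  shows "\<exists>l::nat. \<forall>v\<in>carrier M. (x [^] l) \<odot>\<^bsub>M\<^esub> v = \<zero>\<^bsub>M\<^esub>"
proof -
  interpret M: module R M by fact
  have x: "x \<in> carrier R" "\<And>n::nat. x [^] n \<in> carrier R" using assms(3) by auto
  obtain L where L: "module_length R M = enat L" using assms(2) by (cases "module_length R M") auto
  have bound: "n \<le> L" if "\<forall>i\<le>n. submodule (N i) R M" "\<forall>i<n. N i \<subset> N (Suc i)" for n N
  proof -
    have "enat n \<le> module_length R M"
      unfolding module_length_def using that by (intro Sup_upper) blast
    then show ?thesis using L by simp
  qed
  have "(x [^] Suc L) \<odot>\<^bsub>M\<^esub> v = \<zero>\<^bsub>M\<^esub>" if v: "v \<in> carrier M" for v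
  proof (rule ccontr)
    assume nz: "(x [^] Suc L) \<odot>\<^bsub>M\<^esub> v \<noteq> \<zero>\<^bsub>M\<^esub>"
    have pw: "(x [^] (n + k)) \<odot>\<^bsub>M\<^esub> v = (x [^] n) \<odot>\<^bsub>M\<^esub> ((x [^] k) \<odot>\<^bsub>M\<^esub> v)" for n k :: nat
      using M.smult_assoc1[OF x(2) x(2) v] nat_pow_mult[OF x(1)] by metis
    define C where "C k = {r \<odot>\<^bsub>M\<^esub> ((x [^] k) \<odot>\<^bsub>M\<^esub> v) | r. r \<in> carrier R}" for k :: nat
    have vk: "(x [^] k) \<odot>\<^bsub>M\<^esub> v \<in> carrier M" for k :: nat using x v by simp
    have C: "submodule (C k) R M" for k
    proof (rule M.submoduleI')
      show "C k \<subseteq> carrier M" unfolding C_def using vk by auto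
      have "\<zero>\<^bsub>M\<^esub> = \<zero> \<odot>\<^bsub>M\<^esub> ((x [^] k) \<odot>\<^bsub>M\<^esub> v)" using vk by simp
      then show "\<zero>\<^bsub>M\<^esub> \<in> C k" unfolding C_def by blast
      fix u assume "u \<in> C k"
      then obtain r where r: "u = r \<odot>\<^bsub>M\<^esub> ((x [^] k) \<odot>\<^bsub>M\<^esub> v)" "r \<in> carrier R" unfolding C_def by blast
      show "a \<odot>\<^bsub>M\<^esub> u \<in> C k" if a: "a \<in> carrier R" for a
      proof -
        have "a \<odot>\<^bsub>M\<^esub> u = (a \<otimes> r) \<odot>\<^bsub>M\<^esub> ((x [^] k) \<odot>\<^bsub>M\<^esub> v)" using M.smult_assoc1[OF a r(2) vk] r(1) by simp
        then show ?thesis unfolding C_def using a r(2) by blast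
      qed
      fix w assume "w \<in> C k"
      then obtain s where s: "w = s \<odot>\<^bsub>M\<^esub> ((x [^] k) \<odot>\<^bsub>M\<^esub> v)" "s \<in> carrier R" unfolding C_def by blast
      have "u \<oplus>\<^bsub>M\<^esub> w = (r \<oplus> s) \<odot>\<^bsub>M\<^esub> ((x [^] k) \<odot>\<^bsub>M\<^esub> v)"
        unfolding r(1) s(1) M.smult_l_distr[OF r(2) s(2) vk] ..
      then show "u \<oplus>\<^bsub>M\<^esub> w \<in> C k" unfolding C_def using r(2) s(2) by blast
    qed
    have lt: "C (Suc k) \<subset> C k" if k: "k \<le> L" for k
    proof
      show "C (Suc k) \<subseteq> C k"
      proof
        fix u assume "u \<in> C (Suc k)"
        then obtain r where r: "u = r \<odot>\<^bsub>M\<^esub> ((x [^] Suc k) \<odot>\<^bsub>M\<^esub> v)" "r \<in> carrier R" unfolding C_def by blast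
        have "u = (r \<otimes> x) \<odot>\<^bsub>M\<^esub> ((x [^] k) \<odot>\<^bsub>M\<^esub> v)"
          using r(1) pw[of 1 k] M.smult_assoc1[OF r(2) x(1) vk[of k]] x by simp
        then show "u \<in> C k" unfolding C_def using r(2) x(1) by blast
      qed
      show "C (Suc k) \<noteq> C k"
      proof
        assume eq: "C (Suc k) = C k"
        let ?w = "(x [^] k) \<odot>\<^bsub>M\<^esub> v"
        have "?w = \<one> \<odot>\<^bsub>M\<^esub> ?w" using vk by simp
        then have "?w \<in> C k" unfolding C_def by blast
        then have "?w \<in> C (Suc k)" unfolding eq .
        then obtain r where r: "?w = r \<odot>\<^bsub>M\<^esub> ((x [^] Suc k) \<odot>\<^bsub>M\<^esub> v)" "r \<in> carrier R"
          unfolding C_def by blast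
        have rx: "r \<otimes> x \<in> m" using I_l_closed assms(3) r(2) by simp
        then have rxc: "r \<otimes> x \<in> carrier R" by simp
        have w: "?w = (r \<otimes> x) \<odot>\<^bsub>M\<^esub> ?w"
          using r(1) pw[of 1 k] M.smult_assoc1[OF r(2) x(1) vk[of k]] x by simp
        have "(\<one> \<ominus> r \<otimes> x) \<odot>\<^bsub>M\<^esub> ?w = \<one> \<odot>\<^bsub>M\<^esub> ?w \<oplus>\<^bsub>M\<^esub> (\<ominus> (r \<otimes> x)) \<odot>\<^bsub>M\<^esub> ?w"
          unfolding a_minus_def using rxc vk by (intro M.smult_l_distr) auto
        also have "\<dots> = ?w \<oplus>\<^bsub>M\<^esub> \<ominus>\<^bsub>M\<^esub> ((r \<otimes> x) \<odot>\<^bsub>M\<^esub> ?w)"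
          using M.smult_l_minus[OF rxc vk] vk by simp
        also have "\<dots> = \<zero>\<^bsub>M\<^esub>" unfolding w[symmetric] using vk M.M.r_neg by simp
        finally have z: "(\<one> \<ominus> r \<otimes> x) \<odot>\<^bsub>M\<^esub> ?w = \<zero>\<^bsub>M\<^esub>" .
        have o: "\<one> \<ominus> r \<otimes> x \<in> carrier R" "\<one> \<ominus> r \<otimes> x \<notin> m" using one_minus_m[OF rx] by auto
        obtain t where t: "t \<in> carrier R" "t \<otimes> (\<one> \<ominus> r \<otimes> x) = \<one>" using unit_outside_m[OF o] .
        have "?w = \<zero>\<^bsub>M\<^esub>"
          using M.smult_assoc1[OF t(1) o(1) vk[of k]] z t vk by simp
        then have "(x [^] (Suc L - k + k)) \<odot>\<^bsub>M\<^esub> v = \<zero>\<^bsub>M\<^esub>" unfolding pw using x(2) by simp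
        then show False using nz k by simp
      qed
    qed
    have "\<forall>i<Suc L. C (Suc L - i) \<subset> C (Suc L - Suc i)"
    proof (intro allI impI)
      fix i assume "i < Suc L"
      then show "C (Suc L - i) \<subset> C (Suc L - Suc i)" using lt[of "L - i"] by (simp add: Suc_diff_le)
    qed
    then have "Suc L \<le> L" using C by (intro bound[of "Suc L" "\<lambda>i. C (Suc L - i)"]) auto
    then show False by simp
  qed
  then show ?thesis by blast
qed

context cring
begin

lemma free_module_projective:
  fixes S :: "'i set"
  assumes "finite S"
  shows "projective_module R (free_module R S)"
  unfolding projective_module_def
proof (intro conjI allI impI)
  show "module R (free_module R S)" using free_module_module assms .
next
  fix N :: "('a, ('i \<Rightarrow> 'a) \<Rightarrow> 'a) module" and N' :: "('a, 'i \<Rightarrow> 'a) module" and g h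
  assume h: "module R N \<and> module R N' \<and> g \<in> lin_hom R N N' \<and> g ` carrier N = carrier N' \<and>
    h \<in> lin_hom R (free_module R S) N'"
  show "\<exists>k\<in>lin_hom R (free_module R S) N. \<forall>x\<in>carrier (free_module R S). g (k x) = h x"
  proof (rule free_module_lift[OF assms])
    show "h (unit_vec R i) \<in> g ` carrier N" if "i \<in> S" for i
      using h lin_hom_closed[of h R] unit_vec_carrier[OF assms that] by blast
  qed (use h in auto)
qed

text \<open>If the syzygy module vanishes, the resolution can be cut off there. The work lies in moving the
terms from index set \<open>nat\<close> to the index type over which projective dimension is defined, by the
embedding \<open>\<iota>\<close> of \<open>nat\<close> and the mutually inverse maps \<open>\<sigma>\<close> and \<open>\<tau>\<close> induced by it.\<close>
lemma zero_syzygy_imp_finite_proj_dim: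
  fixes M :: "('a, 'm, 'c) module_scheme"
  assumes M: "module R M" and res: "resolution R M (\<lambda>i. free_n (b i)) e f"
    and i: "i > 0" and Z: "\<And>v. v \<in> carrier (Syz R M b e f i) \<Longrightarrow> v = (\<lambda>j. \<zero>)"
  shows "proj_dim R M \<noteq> \<infinity>"
proof -
  interpret M: module R M by fact
  define \<iota> :: "nat \<Rightarrow> 'm + 'a + nat" where "\<iota> n = Inr (Inr n)" for n
  define \<sigma> :: "('m + 'a + nat \<Rightarrow> 'a) \<Rightarrow> nat \<Rightarrow> 'a" where "\<sigma> w = (\<lambda>n. w (\<iota> n))" for w
  define \<tau> :: "(nat \<Rightarrow> 'a) \<Rightarrow> 'm + 'a + nat \<Rightarrow> 'a" where
    "\<tau> v = (\<lambda>z. case z of Inr (Inr n) \<Rightarrow> v n | _ \<Rightarrow> \<zero>)" for v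
  define P where "P j = free_module R (if j < i then \<iota> ` {..<b j} else {})" for j
  define f' where "f' j = (if j < i then (\<lambda>w. \<tau> (f j (\<sigma> w))) else (\<lambda>w z. \<zero>))" for j
  define e' where "e' = (\<lambda>w. e (\<sigma> w))"
  have st: "\<sigma> (\<tau> v) = v" for v unfolding \<sigma>_def \<tau>_def \<iota>_def by simp
  have Pc: "w \<in> carrier (P j) \<longleftrightarrow> (\<forall>z. w z \<in> carrier R) \<and> (\<forall>z. z \<notin> \<iota> ` {..<b j} \<longrightarrow> w z = \<zero>)" if "j < i" for w j
    unfolding P_def using that by (subst free_module_carrier) auto
  have ts: "\<tau> (\<sigma> w) = w" if "j < i" "w \<in> carrier (P j)" for j w
  proof
    fix z
    show "\<tau> (\<sigma> w) z = w z"
    proof (cases z)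
      case (Inl y)
      then have "z \<notin> \<iota> ` {..<b j}" unfolding \<iota>_def by auto
      then have "w z = \<zero>" using that Pc by blast
      then show ?thesis using Inl unfolding \<tau>_def by simp
    next
      case (Inr z')
      show ?thesis
      proof (cases z')
        case (Inl y)
        then have "z \<notin> \<iota> ` {..<b j}" using Inr unfolding \<iota>_def by auto
        then have "w z = \<zero>" using that Pc by blast
        then show ?thesis using Inl Inr unfolding \<tau>_def by simp
      next
        case (Inr n)
        then show ?thesis using \<open>z = Inr z'\<close> unfolding \<tau>_def \<sigma>_def \<iota>_def by simp
      qed
    qed
  qed
  have sc: "\<sigma> w \<in> carrier (free_n (b j))" if "j < i" "w \<in> carrier (P j)" for j w
    using that unfolding Pc[OF that(1)] free_n_carrier \<sigma>_def \<iota>_def by (auto simp: image_iff)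
  have tc: "\<tau> v \<in> carrier (P j)" if "j < i" "v \<in> carrier (free_n (b j))" for j v
    using that(2) unfolding Pc[OF that(1)] free_n_carrier \<tau>_def \<iota>_def
    by (auto split: sum.splits simp: image_iff Bex_def not_less)
  have s: "\<sigma> \<in> lin_hom R (P j) (free_n (b j))" if "j < i" for j
    by (rule lin_homI) (use sc[OF that] in \<open>auto simp: P_def \<sigma>_def\<close>)
  have t: "\<tau> \<in> lin_hom R (free_n (b j)) (P j)" if "j < i" for j
    by (rule lin_homI) (use tc[OF that] in \<open>auto simp: P_def \<tau>_def fun_eq_iff split: sum.splits\<close>)
  have s_img: "\<sigma> ` carrier (P j) = carrier (free_n (b j))" if "j < i" for j
  proof
    show "carrier (free_n (b j)) \<subseteq> \<sigma> ` carrier (P j)"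
    proof
      fix v assume "v \<in> carrier (free_n (b j))"
      then show "v \<in> \<sigma> ` carrier (P j)" using tc[OF that] st by (intro image_eqI[of v \<sigma> "\<tau> v"]) auto
    qed
  qed (use sc[OF that] in auto)
  have triv: "carrier (P j) = {\<zero>\<^bsub>P j\<^esub>}" if "\<not> j < i" for j
    using that unfolding P_def by (auto simp: free_module_carrier)
  have Pz: "\<zero>\<^bsub>P j\<^esub> = (\<lambda>z. \<zero>)" for j unfolding P_def by simp
  have Pzc: "(\<lambda>z. \<zero>) \<in> carrier (P j)" for j unfolding P_def by (auto simp: free_module_carrier)
  have \<tau>0: "\<tau> (\<lambda>j. \<zero>) = (\<lambda>z. \<zero>)" unfolding \<tau>_def by (auto split: sum.splits)
  have \<tau>eq0: "\<tau> v = (\<lambda>z. \<zero>) \<longleftrightarrow> v = (\<lambda>j. \<zero>)" for v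
  proof
    assume "\<tau> v = (\<lambda>z. \<zero>)"
    then have "\<sigma> (\<tau> v) = (\<lambda>j. \<zero>)" unfolding \<sigma>_def by simp
    then show "v = (\<lambda>j. \<zero>)" unfolding st .
  next
    assume "v = (\<lambda>j. \<zero>)"
    then show "\<tau> v = (\<lambda>z. \<zero>)" using \<tau>0 by simp
  qed
  have Z': "v = (\<lambda>j. \<zero>)" if "v \<in> carrier (free_n (b (i - 1)))"
    "if i = 1 then e v = \<zero>\<^bsub>M\<^esub> else f (i - 1) v = (\<lambda>j. \<zero>)" for v
  proof (rule Z)
    show "v \<in> carrier (Syz R M b e f i)"
      using that by (cases "i = 1") (simp_all add: Syz_def lin_ker_def)
  qed
  have fz: "f (Suc j) (\<lambda>k. \<zero>) = (\<lambda>k. \<zero>)" for j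
    using lin_hom_zero[OF free_module_module free_module_module, of "{..<b (Suc j)}" "{..<b j}" "f (Suc j)"] res
    unfolding resolution_def by simp
  have ez: "e (\<lambda>k. \<zero>) = \<zero>\<^bsub>M\<^esub>"
    using lin_hom_zero[OF free_module_module M, of "{..<b 0}" e] res
    unfolding resolution_def by simp
  have r: "e \<in> lin_hom R (free_n (b 0)) M" "e ` carrier (free_n (b 0)) = carrier M"
    "\<And>j. f (Suc j) \<in> lin_hom R (free_n (b (Suc j))) (free_n (b j))"
    "f 1 ` carrier (free_n (b 1)) = lin_ker (free_n (b 0)) M e"
    "\<And>j. f (Suc (Suc j)) ` carrier (free_n (b (Suc (Suc j)))) = lin_ker (free_n (b (Suc j))) (free_n (b j)) (f (Suc j))"
    using res unfolding resolution_def by auto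
  have "resolution R M P e' f'"
    unfolding resolution_def
  proof (intro conjI allI)
    show "e' \<in> lin_hom R (P 0) M"
      unfolding e'_def by (rule lin_hom_comp[OF s[OF i] r(1)])
    show "e' ` carrier (P 0) = carrier M"
      unfolding e'_def using s_img[OF i] r(2) by (metis image_image)
    show "f' (Suc j) \<in> lin_hom R (P (Suc j)) (P j)" for j
    proof (cases "Suc j < i")
      case True
      then have "j < i" by simp
      then show ?thesis
        using lin_hom_comp[OF lin_hom_comp[OF s[OF True] r(3)] t[of j]] True unfolding f'_def by simp
    next
      case False
      show ?thesis
        by (rule lin_homI) (use False Pzc in \<open>auto simp: f'_def P_def\<close>)
    qed
    have img: "f' (Suc j) ` carrier (P (Suc j)) = \<tau> ` (f (Suc j) ` carrier (free_n (b (Suc j))))" if "Suc j < i" for j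
      unfolding f'_def s_img[OF that, symmetric] using that by (simp add: image_image)
    have img0: "f' (Suc j) ` carrier (P (Suc j)) = {\<lambda>z. \<zero>}" if "\<not> Suc j < i" for j
      using that triv[OF that] unfolding f'_def by simp
    show "f' 1 ` carrier (P 1) = lin_ker (P 0) M e'"
    proof (cases "Suc 0 < i")
      case True
      have "lin_ker (P 0) M e' = \<tau> ` lin_ker (free_n (b 0)) M e"
      proof (intro equalityI subsetI)
        fix w assume "w \<in> lin_ker (P 0) M e'"
        then have w: "w \<in> carrier (P 0)" "e (\<sigma> w) = \<zero>\<^bsub>M\<^esub>" unfolding lin_ker_def e'_def by auto
        then show "w \<in> \<tau> ` lin_ker (free_n (b 0)) M e"
          using ts[OF i w(1)] sc[OF i w(1)] unfolding lin_ker_def by (intro image_eqI[of _ _ "\<sigma> w"]) auto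
      qed (use tc[OF i] st in \<open>auto simp: lin_ker_def e'_def\<close>)
      then show ?thesis using img[OF True] r(4) by simp
    next
      case False
      then have i1: "i = 1" using i by simp
      have "w = (\<lambda>z. \<zero>)" if "w \<in> lin_ker (P 0) M e'" for w
      proof -
        have w: "w \<in> carrier (P 0)" "e (\<sigma> w) = \<zero>\<^bsub>M\<^esub>" using that unfolding lin_ker_def e'_def by auto
        have "\<sigma> w = (\<lambda>j. \<zero>)" using Z'[of "\<sigma> w"] sc[OF i w(1)] w(2) i1 by simp
        then show ?thesis using ts[OF i w(1)] \<tau>0 by simp
      qed
      moreover have "\<sigma> (\<lambda>z. \<zero>) = (\<lambda>j. \<zero>)" unfolding \<sigma>_def by simp
      then have "(\<lambda>z. \<zero>) \<in> lin_ker (P 0) M e'" using Pzc ez unfolding lin_ker_def e'_def by simp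
      ultimately have "lin_ker (P 0) M e' = {\<lambda>z. \<zero>}" by blast
      then show ?thesis using img0[OF False] by simp
    qed
    fix j
    show "f' (Suc (Suc j)) ` carrier (P (Suc (Suc j))) = lin_ker (P (Suc j)) (P j) (f' (Suc j))"
    proof -
      consider "Suc (Suc j) < i" | "i = Suc (Suc j)" | "\<not> Suc j < i" by linarith
      then show ?thesis
      proof cases
        case 1
        then have j: "Suc j < i" by simp
        have "lin_ker (P (Suc j)) (P j) (f' (Suc j)) = \<tau> ` lin_ker (free_n (b (Suc j))) (free_n (b j)) (f (Suc j))"
        proof (intro equalityI subsetI)
          fix w assume "w \<in> lin_ker (P (Suc j)) (P j) (f' (Suc j))"
          then have w: "w \<in> carrier (P (Suc j))" "f (Suc j) (\<sigma> w) = (\<lambda>j. \<zero>)"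
            using j \<tau>eq0 unfolding lin_ker_def f'_def Pz by auto
          then show "w \<in> \<tau> ` lin_ker (free_n (b (Suc j))) (free_n (b j)) (f (Suc j))"
            using ts[OF j w(1)] sc[OF j w(1)] unfolding lin_ker_def by (intro image_eqI[of _ _ "\<sigma> w"]) auto
        qed (use tc[OF j] st j \<tau>0 in \<open>auto simp: lin_ker_def f'_def Pz\<close>)
        then show ?thesis using img[OF 1] r(5) by simp
      next
        case 2
        then have j: "Suc j < i" by simp
        have "w = (\<lambda>z. \<zero>)" if "w \<in> lin_ker (P (Suc j)) (P j) (f' (Suc j))" for w
        proof -
          have w: "w \<in> carrier (P (Suc j))" "f (Suc j) (\<sigma> w) = (\<lambda>j. \<zero>)"
            using that j \<tau>eq0 unfolding lin_ker_def f'_def Pz by auto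
          have "\<sigma> w = (\<lambda>j. \<zero>)" using Z'[of "\<sigma> w"] sc[OF j w(1)] w(2) 2 by simp
          then show ?thesis using ts[OF j w(1)] \<tau>0 by simp
        qed
        moreover have "\<sigma> (\<lambda>z. \<zero>) = (\<lambda>j. \<zero>)" unfolding \<sigma>_def by simp
        then have "(\<lambda>z. \<zero>) \<in> lin_ker (P (Suc j)) (P j) (f' (Suc j))"
          using Pzc fz[of j] j \<tau>0 unfolding lin_ker_def f'_def Pz by simp
        ultimately have "lin_ker (P (Suc j)) (P j) (f' (Suc j)) = {\<lambda>z. \<zero>}" by blast
        then show ?thesis using img0[of "Suc j"] 2 by simp
      next
        case 3
        then have "lin_ker (P (Suc j)) (P j) (f' (Suc j)) = {\<lambda>z. \<zero>}"
          using triv[OF 3] unfolding lin_ker_def f'_def Pz by auto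
        then show ?thesis using img0[of "Suc j"] 3 by simp
      qed
    qed
  qed
  moreover have "projective_module R (P j)" for j
    unfolding P_def by (rule free_module_projective) simp
  moreover have "\<forall>j>i. carrier (P j) = {\<zero>\<^bsub>P j\<^esub>}" using triv by simp
  ultimately have "proj_dim R M \<le> enat i"
    unfolding proj_dim_def by (intro Inf_lower) blast
  then show ?thesis
  proof (intro notI)
    assume "proj_dim R M \<le> enat i" "proj_dim R M = \<infinity>"
    then show False by simp
  qed
qed

end

section \<open>Syzygies of a module of finite length\<close>

locale finite_length_resolution = noetherian_local_ring R m + M: module R M
  for R :: "('a, 'r) ring_scheme" (structure) and m and M :: "('a, 'm, 'c) module_scheme" (structure) +
  fixes b :: "nat \<Rightarrow> nat" and e :: "(nat \<Rightarrow> 'a) \<Rightarrow> 'm" and f :: "nat \<Rightarrow> (nat \<Rightarrow> 'a) \<Rightarrow> nat \<Rightarrow> 'a"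
  assumes finite_length: "module_length R M < \<infinity>"
    and infinite_proj_dim: "proj_dim R M = \<infinity>"
    and minimal: "minimal_free_resolution R m M b e f"
begin

text \<open>Index shift: \<open>kern j\<close> is the syzygy module with number \<open>j + 1\<close>.\<close>
definition kern :: "nat \<Rightarrow> (nat \<Rightarrow> 'a) set" where
  "kern j = (case j of 0 \<Rightarrow> lin_ker (free_n (b 0)) M e
     | Suc k \<Rightarrow> lin_ker (free_n (b (Suc k))) (free_n (b k)) (f (Suc k)))"

lemma kern_simps:
  "kern 0 = lin_ker (free_n (b 0)) M e"
  "kern (Suc k) = lin_ker (free_n (b (Suc k))) (free_n (b k)) (f (Suc k))"
  unfolding kern_def by simp_all

lemma kern_subset: "v \<in> kern j \<Longrightarrow> v \<in> carrier (free_n (b j))"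
  by (cases j) (simp_all add: kern_simps lin_ker_def)

lemma Syz_carrier: "carrier (Syz R M b e f (Suc j)) = kern j"
  unfolding Syz_def by (cases j) (simp_all add: kern_simps)

lemma F_module: "module R (free_n n)"
  by (rule free_module_module) simp

lemma res:
  "e \<in> lin_hom R (free_n (b 0)) M" "e ` carrier (free_n (b 0)) = carrier M"
  "f (Suc j) \<in> lin_hom R (free_n (b (Suc j))) (free_n (b j))"
  "f (Suc j) ` carrier (free_n (b (Suc j))) = kern j"
  using minimal unfolding minimal_free_resolution_def resolution_def
  by (auto simp: kern_def split: nat.split)

lemma kern_module: "submodule (kern j) R (free_n (b j))"
  using lin_ker_submodule[OF F_module M.module_axioms res(1)]
    lin_ker_submodule[OF F_module F_module res(3)]
  by (cases j) (simp_all add: kern_simps)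

lemma kern_nonzero:
  obtains v where "v \<in> kern j" "v \<noteq> (\<lambda>i. \<zero>)"
proof -
  have "\<not> (\<forall>v. v \<in> carrier (Syz R M b e f (Suc j)) \<longrightarrow> v = (\<lambda>i. \<zero>))"
    using zero_syzygy_imp_finite_proj_dim[OF M.module_axioms, of b e f "Suc j"] infinite_proj_dim minimal
    unfolding minimal_free_resolution_def by auto
  then show thesis using that unfolding Syz_carrier by blast
qed

lemma rank_pos: "b j > 0"
proof (rule ccontr)
  assume "\<not> b j > 0"
  obtain v where v: "v \<in> kern j" "v \<noteq> (\<lambda>i. \<zero>)" using kern_nonzero .
  have "v i = \<zero>" for i
    using kern_subset[OF v(1)] \<open>\<not> b j > 0\<close> by (simp add: free_n_carrier)
  then show False using v(2) by auto
qed

lemma minimal_entries: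
  assumes "v \<in> carrier (free_n (b (Suc j)))"
  shows "f (Suc j) v i \<in> m"
proof -
  interpret F: module R "free_n (b j)" by (rule F_module)
  let ?N = "{v \<in> carrier (free_n (b j)). \<forall>i. v i \<in> m}"
  have "submodule ?N R (free_n (b j))"
    by (rule F.submoduleI') (auto simp: free_n_carrier I_l_closed)
  moreover have "{a \<odot>\<^bsub>free_n (b j)\<^esub> x | a x. a \<in> m \<and> x \<in> carrier (free_n (b j))} \<subseteq> ?N"
    using I_r_closed by (auto simp: free_n_carrier)
  ultimately have "ideal_smult R m (free_n (b j)) \<subseteq> ?N"
    unfolding ideal_smult_def submodule_span_def by (intro Inter_lower) simp
  moreover have "f (Suc j) v \<in> ideal_smult R m (free_n (b j))"
    using minimal assms unfolding minimal_free_resolution_def by blast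
  ultimately show ?thesis by blast
qed

text \<open>By minimality the matrix of \<open>f (Suc j)\<close> has entries in \<open>m\<close>, so it maps \<open>P F\<close> into \<open>m P F\<close>; the
ideal \<open>J\<close> stands for any ideal containing \<open>m P\<close>.\<close>
lemma entries_in_product:
  assumes v: "v \<in> carrier (free_n (b (Suc j)))" "\<And>i. v i \<in> P" and P: "P \<subseteq> carrier R"
    and J: "ideal J R" "\<And>a p. a \<in> m \<Longrightarrow> p \<in> P \<Longrightarrow> a \<otimes> p \<in> J"
  shows "f (Suc j) v k \<in> J"
proof -
  interpret J: ideal J R by fact
  let ?F = "free_n (b (Suc j))"
  let ?N = "{w \<in> carrier ?F. f (Suc j) w k \<in> J}"
  interpret F: module R ?F by (rule F_module)
  have "v \<in> ?N"
  proof (rule free_module_span[OF _ v(1)])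
    show "(\<lambda>i. \<zero>) \<in> ?N"
      using lin_hom_zero[OF F_module F_module res(3)[of j]] J.zero_closed by (simp add: free_n_carrier)
    show "(\<lambda>i. w i \<oplus> w' i) \<in> ?N" if "w \<in> ?N" "w' \<in> ?N" for w w'
    proof -
      have "f (Suc j) (w \<oplus>\<^bsub>?F\<^esub> w') k = f (Suc j) w k \<oplus> f (Suc j) w' k"
        using that lin_hom_add[OF res(3)[of j], of w w'] by simp
      then show ?thesis using that J.a_closed by (auto simp: free_n_carrier)
    qed
    fix i assume "i \<in> {..<b (Suc j)}"
    then have u: "unit_vec R i \<in> carrier ?F" by (intro unit_vec_carrier) auto
    have vi: "v i \<in> carrier R" using v(2) P by blast
    have "f (Suc j) (v i \<odot>\<^bsub>?F\<^esub> unit_vec R i) k = v i \<otimes> f (Suc j) (unit_vec R i) k"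
      using lin_hom_smult[OF res(3)[of j] vi u] by simp
    also have "\<dots> = f (Suc j) (unit_vec R i) k \<otimes> v i"
      using m_comm vi minimal_entries[OF u] by simp
    also have "\<dots> \<in> J" using J(2)[OF minimal_entries[OF u] v(2)] .
    finally show "(\<lambda>l. v i \<otimes> unit_vec R i l) \<in> ?N"
      using F.smult_closed[OF vi u] by simp
  qed simp
  then show ?thesis by simp
qed

lemma killed:
  assumes "x \<in> m"
  obtains l :: nat where "\<forall>v\<in>carrier M. (x [^] Suc l) \<odot>\<^bsub>M\<^esub> v = \<zero>\<^bsub>M\<^esub>"
proof -
  obtain l :: nat where l: "\<And>v. v \<in> carrier M \<Longrightarrow> (x [^] l) \<odot>\<^bsub>M\<^esub> v = \<zero>\<^bsub>M\<^esub>"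
    using finite_length_imp_killed[OF M.module_axioms finite_length assms] by blast
  have "(x [^] Suc l) \<odot>\<^bsub>M\<^esub> v = \<zero>\<^bsub>M\<^esub>" if "v \<in> carrier M" for v
    using l[of "x \<odot>\<^bsub>M\<^esub> v"] that assms M.smult_assoc1[of "x [^] l" x v] by simp
  then show thesis using that by blast
qed

text \<open>The pair \<open>(q, p)\<close> of ranks in a presentation of \<open>kern j\<close>: the sums of the Betti numbers with index at
most \<open>j\<close> of the parity of \<open>j\<close> and of the opposite parity. The difference \<open>q - p\<close> is the rank of
\<open>kern j\<close> at each prime other than \<open>m\<close>.\<close>
fun dims :: "nat \<Rightarrow> nat \<times> nat" where
  "dims 0 = (b 0, 0)"
| "dims (Suc j) = (b (Suc j) + snd (dims j), fst (dims j))"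

lemma kern_presented:
  assumes "x \<in> m"
  shows "\<exists>D. presents_upto x (kern j) (fst (dims j)) (snd (dims j)) D"
proof (induction j)
  case 0
  have x: "x \<in> carrier R" using assms by auto
  interpret F: module R "free_n (b 0)" by (rule F_module)
  obtain l :: nat where l: "\<forall>v\<in>carrier M. (x [^] Suc l) \<odot>\<^bsub>M\<^esub> v = \<zero>\<^bsub>M\<^esub>"
    by (rule killed[OF assms])
  have "(\<lambda>v i. \<zero>) \<in> lin_hom R (free_n (b 0)) (free_n 0)"
    by (rule lin_homI) (auto simp: free_module_carrier)
  moreover have "kern 0 \<subseteq> lin_ker (free_n (b 0)) (free_n 0) (\<lambda>v i. \<zero>)"
    unfolding kern_simps lin_ker_def by auto
  moreover have "\<forall>u\<in>carrier (free_n 0). \<exists>v\<in>carrier (free_n (b 0)). (\<lambda>i. x [^] (0::nat) \<otimes> u i) = (\<lambda>i. \<zero>)"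
    by (auto simp: free_module_carrier)
  moreover have "\<forall>v\<in>lin_ker (free_n (b 0)) (free_n 0) (\<lambda>v i. \<zero>). (\<lambda>i. x [^] Suc l \<otimes> v i) \<in> kern 0"
  proof
    fix v assume "v \<in> lin_ker (free_n (b 0)) (free_n 0) (\<lambda>v i. \<zero>)"
    then have v: "v \<in> carrier (free_n (b 0))" unfolding lin_ker_def by simp
    have xc: "x [^] Suc l \<in> carrier R" using x by blast
    show "(\<lambda>i. x [^] Suc l \<otimes> v i) \<in> kern 0"
      unfolding kern_simps lin_ker_def
      using lin_hom_smult[OF res(1) xc v] F.smult_closed[OF xc v] l lin_hom_closed[OF res(1) v]
      by (simp del: nat_pow_Suc)
  qed
  ultimately have "presents_upto x (kern 0) (b 0) 0 (\<lambda>v i. \<zero>)"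
    unfolding presents_upto_def by blast
  then show ?case unfolding dims.simps fst_conv snd_conv by blast
next
  case (Suc j)
  then obtain D where "presents_upto x (kern j) (fst (dims j)) (snd (dims j)) D" by blast
  from presents_upto_step[OF this _ res(3) res(4)] assms show ?case
    unfolding kern_simps by simp
qed

text \<open>The localisation of \<open>kern j\<close> at \<open>P\<close> vanishes.\<close>
definition locally_zero :: "'a set \<Rightarrow> nat \<Rightarrow> bool" where
  "locally_zero P j \<longleftrightarrow> (\<forall>v\<in>kern j. \<exists>u\<in>carrier R - P. (\<lambda>i. u \<otimes> v i) = (\<lambda>i. \<zero>))"

lemma locally_zero_not_m:
  assumes "locally_zero P j"
  shows "P \<noteq> m"
proof
  assume "P = m"
  obtain v where v: "v \<in> kern j" "v \<noteq> (\<lambda>i. \<zero>)" using kern_nonzero .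
  obtain u where u: "u \<in> carrier R" "u \<notin> m" "(\<lambda>i. u \<otimes> v i) = (\<lambda>i. \<zero>)"
    using assms v(1) \<open>P = m\<close> unfolding locally_zero_def by blast
  obtain w where w: "w \<in> carrier R" "w \<otimes> u = \<one>" using unit_outside_m[OF u(1,2)] .
  have "v i = \<zero>" for i
  proof -
    have vi: "v i \<in> carrier R" using free_module_closed[OF kern_subset[OF v(1)]] .
    have "v i = (w \<otimes> u) \<otimes> v i" using w vi by simp
    also have "\<dots> = w \<otimes> (u \<otimes> v i)" by (rule m_assoc) fact+
    also have "\<dots> = \<zero>" using fun_cong[OF u(3), of i] w by simp
    finally show ?thesis .
  qed
  then show False using v(2) by auto
qed

lemma outside_prime:
  assumes "primeideal P R" "P \<noteq> m"
  obtains x where "x \<in> m" "x \<in> carrier R - P"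
proof -
  have "\<not> m \<subseteq> P" using prime_le[OF assms(1)] assms(2) by blast
  then show thesis using that a_subset by blast
qed

text \<open>Only finitely many basis vectors of the next free module have to be treated, since their images
generate \<open>kern j\<close>.\<close>
lemma locally_zero_uniform:
  assumes P: "primeideal P R" and Z: "locally_zero P j"
  obtains s where "s \<in> carrier R - P" "\<forall>v\<in>kern j. \<forall>i. s \<otimes> v i = \<zero>"
proof -
  let ?F = "free_n (b (Suc j))"
  have fk: "f (Suc j) v \<in> kern j" if "v \<in> carrier ?F" for v using res(4)[of j] that by blast
  have fc: "f (Suc j) v i \<in> carrier R" if "v \<in> carrier ?F" for v i
    using minimal_entries[OF that] by simp
  have "\<exists>s\<in>carrier R - P. \<forall>l\<in>T. \<forall>i. s \<otimes> f (Suc j) (unit_vec R l) i = \<zero>"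
    if "finite T" "T \<subseteq> {..<b (Suc j)}" for T
    using that
  proof (induction T rule: finite_induct)
    case empty
    then show ?case using primeideal_one[OF P] by auto
  next
    case (insert l T)
    then obtain s where s: "s \<in> carrier R - P" "\<forall>l\<in>T. \<forall>i. s \<otimes> f (Suc j) (unit_vec R l) i = \<zero>" by auto
    have u: "unit_vec R l \<in> carrier ?F"
      using insert.prems by (intro unit_vec_carrier) auto
    obtain t where t: "t \<in> carrier R - P" "(\<lambda>i. t \<otimes> f (Suc j) (unit_vec R l) i) = (\<lambda>i. \<zero>)"
      using Z fk[OF u] unfolding locally_zero_def by auto
    have "(s \<otimes> t) \<otimes> f (Suc j) (unit_vec R l') i = \<zero>" if l': "l' \<in> insert l T" for l' i
    proof (cases "l' = l")
      case True
      have "(s \<otimes> t) \<otimes> f (Suc j) (unit_vec R l) i = s \<otimes> (t \<otimes> f (Suc j) (unit_vec R l) i)"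
        using s t fc[OF u, of i] by (simp add: m_assoc)
      then show ?thesis using True fun_cong[OF t(2), of i] s by simp
    next
      case False
      have uc: "unit_vec R l' \<in> carrier ?F"
        using insert.prems l' by (intro unit_vec_carrier) auto
      have "(s \<otimes> t) \<otimes> f (Suc j) (unit_vec R l') i = t \<otimes> (s \<otimes> f (Suc j) (unit_vec R l') i)"
        using s t fc[OF uc, of i] by (simp add: m_ac)
      then show ?thesis using False l' s t by simp
    qed
    then show ?case using primeideal_not_mult[OF P s(1) t(1)] by blast
  qed
  from this[of "{..<b (Suc j)}"] obtain s where s: "s \<in> carrier R - P"
    "\<And>l i. l < b (Suc j) \<Longrightarrow> s \<otimes> f (Suc j) (unit_vec R l) i = \<zero>" by auto
  have sc: "s \<in> carrier R" using s by simp
  interpret F: module R ?F by (rule F_module)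
  have "s \<otimes> f (Suc j) v k = \<zero>" if v: "v \<in> carrier ?F" for v k
  proof -
    let ?N = "{w \<in> carrier ?F. s \<otimes> f (Suc j) w k = \<zero>}"
    have "v \<in> ?N"
    proof (rule free_module_span[OF _ v])
      show "(\<lambda>i. \<zero>) \<in> ?N"
        using lin_hom_zero[OF F_module F_module res(3)[of j]] sc by (simp add: free_n_carrier)
      show "(\<lambda>i. w i \<oplus> w' i) \<in> ?N" if "w \<in> ?N" "w' \<in> ?N" for w w'
      proof -
        have "f (Suc j) (w \<oplus>\<^bsub>?F\<^esub> w') k = f (Suc j) w k \<oplus> f (Suc j) w' k"
          using that lin_hom_add[OF res(3)[of j], of w w'] by simp
        then show ?thesis using that sc fc by (auto simp: free_n_carrier r_distr)
      qed
      fix i assume i: "i \<in> {..<b (Suc j)}"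
      then have u: "unit_vec R i \<in> carrier ?F" by (intro unit_vec_carrier) auto
      have vi: "v i \<in> carrier R" using free_module_closed[OF v] .
      have "s \<otimes> f (Suc j) (v i \<odot>\<^bsub>?F\<^esub> unit_vec R i) k = v i \<otimes> (s \<otimes> f (Suc j) (unit_vec R i) k)"
        using lin_hom_smult[OF res(3)[of j] vi u] fc[OF u] sc vi by (simp add: m_lcomm)
      also have "\<dots> = \<zero>" using s(2) i vi by simp
      finally show "(\<lambda>l. v i \<otimes> unit_vec R i l) \<in> ?N"
        using F.smult_closed[OF vi u] by simp
    qed simp
    then show ?thesis by simp
  qed
  then have kill: "\<forall>v\<in>kern j. \<forall>i. s \<otimes> v i = \<zero>"
    unfolding res(4)[of j, symmetric] by auto
  show thesis by (rule that[OF s(1) kill])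
qed

text \<open>Choose \<open>x \<in> m\<close> outside \<open>P\<close> and \<open>s \<notin> P\<close> killing \<open>kern j\<close>. Up to factors outside \<open>P\<close>, the map \<open>D\<close> is
surjective, and also injective, so its section \<open>E\<close> is surjective; a strict inequality between
the ranks would make an element outside the prime \<open>P\<close> nilpotent.\<close>
lemma locally_zero_dims:
  assumes P: "primeideal P R" and Z: "locally_zero P j"
  shows "fst (dims j) = snd (dims j)"
proof -
  let ?q = "fst (dims j)" and ?p = "snd (dims j)"
  have Pm: "P \<noteq> m" using locally_zero_not_m[OF Z] .
  obtain x where x: "x \<in> m" "x \<in> carrier R - P" using outside_prime[OF P Pm] .
  obtain s where s: "s \<in> carrier R - P" "\<forall>v\<in>kern j. \<forall>i. s \<otimes> v i = \<zero>"
    by (rule locally_zero_uniform[OF P Z])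
  obtain D where "presents_upto x (kern j) ?q ?p D" using kern_presented[OF x(1)] by blast
  then obtain c k :: nat where D: "D \<in> lin_hom R (free_n ?q) (free_n ?p)" "kern j \<subseteq> lin_ker (free_n ?q) (free_n ?p) D"
    "\<forall>u\<in>carrier (free_n ?p). \<exists>v\<in>carrier (free_n ?q). (\<lambda>i. x [^] c \<otimes> u i) = D v"
    "\<And>v. v \<in> lin_ker (free_n ?q) (free_n ?p) D \<Longrightarrow> (\<lambda>i. x [^] k \<otimes> v i) \<in> kern j"
    unfolding presents_upto_def by blast
  interpret Pp: module R "free_n ?p" by (rule F_module)
  interpret Q: module R "free_n ?q" by (rule F_module)
  have xc: "x [^] n \<in> carrier R - P" for n :: nat using primeideal_not_pow[OF P x(2)] .
  then have xcc: "x [^] n \<in> carrier R" for n :: nat by blast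
  have sc: "s \<in> carrier R" using s(1) by simp
  have not_nil: "a [^] n \<noteq> \<zero>" if "a \<in> carrier R - P" for a and n :: nat
    using primeideal_not_pow[OF P that, of n] additive_subgroup.zero_closed[OF ideal.axioms(1)[OF primeideal.axioms(1)[OF P]]]
    by auto
  have "\<not> ?q < ?p"
  proof
    assume "?q < ?p"
    then have "\<exists>n::nat. (x [^] c) [^] n = \<zero>"
      by (rule rank_lt_imp_nilpotent[OF noetherian_ring_axioms D(1) xcc]) (use D(3) in simp)
    then show False using not_nil[OF xc[of c]] by blast
  qed
  moreover have "\<not> ?p < ?q"
  proof
    assume lt: "?p < ?q"
    obtain E where E: "E \<in> lin_hom R (free_n ?p) (free_n ?q)"
      "\<And>u. u \<in> carrier (free_n ?p) \<Longrightarrow> D (E u) = (\<lambda>i. x [^] c \<otimes> u i)"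
      using quasi_section[OF D(1) xcc D(3)] by metis
    let ?a = "s \<otimes> x [^] (k + c)"
    have a: "?a \<in> carrier R - P" using primeideal_not_mult[OF P s(1) xc] .
    then have ac: "?a \<in> carrier R" by blast
    have "\<exists>v\<in>carrier (free_n ?p). ?a \<odot>\<^bsub>free_n ?q\<^esub> u = E v" if u: "u \<in> carrier (free_n ?q)" for u
    proof -
      have Du: "D u \<in> carrier (free_n ?p)" using lin_hom_closed[OF D(1) u] .
      have EDu: "E (D u) \<in> carrier (free_n ?q)" using lin_hom_closed[OF E(1) Du] .
      have Dui: "D u i \<in> carrier R" "u i \<in> carrier R" "E (D u) i \<in> carrier R" for i
        using Du u EDu free_module_closed by metis+
      have "(\<lambda>i. x [^] c \<otimes> u i \<oplus> (\<ominus> \<one>) \<otimes> E (D u) i) \<in> lin_ker (free_n ?q) (free_n ?p) D"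
        by (rule quasi_section_defect[OF D(1) E(1) _ xcc u]) (rule E(2))
      from bspec[OF s(2) D(4)[OF this]]
      have z: "s \<otimes> (x [^] k \<otimes> (x [^] c \<otimes> u i \<oplus> (\<ominus> \<one>) \<otimes> E (D u) i)) = \<zero>" for i by simp
      have sx: "s \<otimes> x [^] k \<in> carrier R" using sc xcc by simp
      have "?a \<otimes> u i = (s \<otimes> x [^] k) \<otimes> E (D u) i" for i
      proof -
        have "?a \<otimes> u i = (s \<otimes> (x [^] k \<otimes> x [^] c)) \<otimes> u i" using nat_pow_mult x by simp
        also have "\<dots> = s \<otimes> (x [^] k \<otimes> (x [^] c \<otimes> u i \<oplus> (\<ominus> \<one>) \<otimes> E (D u) i)) \<oplus> (s \<otimes> x [^] k) \<otimes> E (D u) i"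
          using Dui[of i] xcc[of k] xcc[of c] sc by algebra
        also have "\<dots> = (s \<otimes> x [^] k) \<otimes> E (D u) i" unfolding z using Dui[of i] sx by simp
        finally show ?thesis .
      qed
      then have "?a \<odot>\<^bsub>free_n ?q\<^esub> u = (s \<otimes> x [^] k) \<odot>\<^bsub>free_n ?q\<^esub> E (D u)" by simp
      also have "\<dots> = E ((s \<otimes> x [^] k) \<odot>\<^bsub>free_n ?p\<^esub> D u)" using lin_hom_smult[OF E(1) sx Du] ..
      finally show ?thesis using Pp.smult_closed[OF sx Du] by blast
    qed
    then have "\<exists>n::nat. ?a [^] n = \<zero>"
      by (rule rank_lt_imp_nilpotent[OF noetherian_ring_axioms E(1) ac lt])
    then show False using not_nil[OF a] by blast
  qed
  ultimately show ?thesis by simp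
qed

text \<open>The equality of ranks obtained at the one prime \<open>P\<close> is used here for all \<open>x \<in> m\<close>: this is how vanishing
at \<open>P\<close> spreads to the other primes, even over different components of the spectrum.\<close>
lemma locally_zero_torsion:
  assumes P: "primeideal P R" and Z: "locally_zero P j" and x: "x \<in> m" and v: "v \<in> kern j"
  shows "\<exists>n::nat. \<forall>i. x [^] n \<otimes> v i = \<zero>"
proof -
  define n where "n = fst (dims j)"
  interpret F: module R "free_n n" by (rule F_module)
  have xR: "x \<in> carrier R" using x by simp
  obtain D where "presents_upto x (kern j) n n D"
    using kern_presented[OF x, of j] locally_zero_dims[OF P Z] unfolding n_def by auto
  then obtain c :: nat where D: "D \<in> lin_hom R (free_n n) (free_n n)" "kern j \<subseteq> lin_ker (free_n n) (free_n n) D"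
    "\<forall>u\<in>carrier (free_n n). \<exists>v\<in>carrier (free_n n). (\<lambda>i. x [^] c \<otimes> u i) = D v"
    unfolding presents_upto_def by blast
  have z: "submodule {\<zero>\<^bsub>free_n n\<^esub>} R (free_n n)"
    by (rule F.submoduleI') (auto simp: free_n_carrier)
  have vc: "v \<in> carrier (free_n n)" "D v = \<zero>\<^bsub>free_n n\<^esub>" using D(2) v unfolding lin_ker_def by auto
  have "\<exists>k::nat. ((x [^] c) [^] k) \<odot>\<^bsub>free_n n\<^esub> v \<in> {\<zero>\<^bsub>free_n n\<^esub>}"
  proof (rule F.acc_endo_torsion[OF free_module_acc[OF noetherian_ring_axioms] D(1) z])
    show "D w \<in> {\<zero>\<^bsub>free_n n\<^esub>}" if "w \<in> {\<zero>\<^bsub>free_n n\<^esub>}" for w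
      using that lin_hom_zero[OF F_module F_module D(1)] by blast
    show "\<exists>w\<in>carrier (free_n n). \<exists>w'\<in>{\<zero>\<^bsub>free_n n\<^esub>}. (x [^] c) \<odot>\<^bsub>free_n n\<^esub> u = D w \<oplus>\<^bsub>free_n n\<^esub> w'"
      if u: "u \<in> carrier (free_n n)" for u
    proof -
      obtain w where w: "w \<in> carrier (free_n n)" "(\<lambda>i. x [^] c \<otimes> u i) = D w" using D(3) u by blast
      have "(x [^] c) \<odot>\<^bsub>free_n n\<^esub> u = D w \<oplus>\<^bsub>free_n n\<^esub> \<zero>\<^bsub>free_n n\<^esub>"
        using F.M.r_zero[OF lin_hom_closed[OF D(1) w(1)]] w(2) by simp
      then show ?thesis using w(1) by blast
    qed
  qed (use vc xR in auto)
  then obtain k :: nat where "((x [^] c) [^] k) \<odot>\<^bsub>free_n n\<^esub> v = \<zero>\<^bsub>free_n n\<^esub>" by blast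
  then have "(x [^] c) [^] k \<otimes> v i = \<zero>" for i by (simp add: fun_eq_iff)
  then have "\<forall>i. x [^] (c * k) \<otimes> v i = \<zero>" using nat_pow_pow[OF xR] by simp
  then show ?thesis by blast
qed

text \<open>The module \<open>kern 0\<close> contains \<open>x\<^sup>l\<close> times a basis vector as soon as \<open>x\<^sup>l\<close> kills \<open>M\<close>.\<close>
lemma not_locally_zero_0:
  assumes P: "primeideal P R"
  shows "\<not> locally_zero P 0"
proof
  assume Z: "locally_zero P 0"
  obtain x where x: "x \<in> m" "x \<in> carrier R - P" using outside_prime[OF P locally_zero_not_m[OF Z]] .
  obtain l :: nat where l: "\<forall>v\<in>carrier M. (x [^] Suc l) \<odot>\<^bsub>M\<^esub> v = \<zero>\<^bsub>M\<^esub>"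
    by (rule killed[OF x(1)])
  let ?X = "x [^] Suc l" and ?F = "free_n (b 0)"
  have X: "?X \<in> carrier R - P" using primeideal_not_pow[OF P x(2)] .
  then have Xc: "?X \<in> carrier R" by blast
  interpret F: module R ?F by (rule F_module)
  have u: "unit_vec R 0 \<in> carrier ?F" using rank_pos[of 0] by (intro unit_vec_carrier) auto
  have "?X \<odot>\<^bsub>?F\<^esub> unit_vec R 0 \<in> kern 0"
    unfolding kern_simps lin_ker_def
    using F.smult_closed[OF Xc u] lin_hom_smult[OF res(1) Xc u] bspec[OF l lin_hom_closed[OF res(1) u]]
    by (simp del: nat_pow_Suc)
  then obtain s where s: "s \<in> carrier R - P" "(\<lambda>i. s \<otimes> (?X \<odot>\<^bsub>?F\<^esub> unit_vec R 0) i) = (\<lambda>i. \<zero>)"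
    using Z unfolding locally_zero_def by blast
  have "s \<otimes> ?X = \<zero>"
    using fun_cong[OF s(2), of 0] Xc unfolding unit_vec_def by (simp del: nat_pow_Suc)
  then show False
    using primeideal_not_mult[OF P s(1) X] additive_subgroup.zero_closed[OF ideal.axioms(1)[OF primeideal.axioms(1)[OF P]]]
    by simp
qed

end

section \<open>Syzygies over a Buchsbaum ring\<close>

lemma krull_dim_greater:
  assumes "enat n < krull_dim R"
  obtains k p where "k > n" "\<forall>i\<le>k. p i \<in> Spec R" "\<forall>i<k. p i \<subset> p (Suc i)"
proof -
  obtain c where c: "c \<in> {enat k | k. \<exists>p. (\<forall>i\<le>k. p i \<in> Spec R) \<and> (\<forall>i<k. p i \<subset> p (Suc i))}" "enat n < c"
    using assms unfolding krull_dim_def less_Sup_iff by blast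
  then obtain k p where "c = enat k" "\<forall>i\<le>k. p i \<in> Spec R" "\<forall>i<k. p i \<subset> p (Suc i)" by blast
  then show thesis using that[of k p] c(2) by simp
qed

locale buchsbaum_resolution = finite_length_resolution R m M b e f + buchsbaum_local_ring R m
  for R :: "('a, 'r) ring_scheme" (structure) and m and M :: "('a, 'm, 'c) module_scheme" (structure)
    and b :: "nat \<Rightarrow> nat" and e :: "(nat \<Rightarrow> 'a) \<Rightarrow> 'm"
    and f :: "nat \<Rightarrow> (nat \<Rightarrow> 'a) \<Rightarrow> nat \<Rightarrow> 'a" +
  fixes d :: nat
  assumes dim: "krull_dim R = enat d" and dim_gt_1: "d > 1"
begin

lemma socle_vec_to_zero:
  assumes "v \<in> carrier (free_n (b (Suc j)))" "\<And>i. v i \<in> socle"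
  shows "f (Suc j) v = (\<lambda>i. \<zero>)"
proof
  fix k
  have "f (Suc j) v k \<in> {\<zero>}"
    by (rule entries_in_product[OF assms _ zeroideal]) (auto simp: socle_def)
  then show "f (Suc j) v k = \<zero>" by simp
qed

lemma locally_zero_socle:
  assumes "primeideal P R" "locally_zero P j" "v \<in> kern j"
  shows "v i \<in> socle"
proof -
  obtain x y where xy: "x \<in> m" "y \<in> m"
    "\<forall>n::nat. \<forall>r\<in>carrier R. x [^] n \<otimes> r = \<zero> \<longrightarrow> r \<in> socle"
    by (rule parameters_exist[OF dim dim_gt_1])
  obtain n :: nat where "\<forall>i. x [^] n \<otimes> v i = \<zero>"
    using locally_zero_torsion[OF assms(1,2) xy(1) assms(3)] by blast
  then show ?thesis using xy(3) free_module_closed[OF kern_subset[OF assms(3)]] by blast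
qed

text \<open>Let \<open>h \<noteq> 0\<close> be an entry of an element of the syzygy module, so \<open>h\<close> lies in the socle. Then \<open>h\<close> times a basis
vector is a cycle one step earlier, hence equal to \<open>f v\<close>. Multiplying \<open>v\<close> by the parameter \<open>x\<close> lands
in the syzygy module, so \<open>x\<^sup>2\<close> kills \<open>v\<close>. Thus \<open>v\<close> has socle entries and \<open>f v = 0\<close>, a contradiction.\<close>
lemma not_locally_zero_ge_2:
  assumes P: "primeideal P R"
  shows "\<not> locally_zero P (Suc (Suc j))"
proof
  assume Z: "locally_zero P (Suc (Suc j))"
  note S = locally_zero_socle[OF P Z]
  obtain w where w: "w \<in> kern (Suc (Suc j))" "w \<noteq> (\<lambda>i. \<zero>)" by (rule kern_nonzero)
  then obtain k where k: "w k \<noteq> \<zero>" by blast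
  define h where "h = w k"
  have h: "h \<in> socle" "h \<noteq> \<zero>" using S[OF w(1)] k unfolding h_def by auto
  have hR: "h \<in> carrier R" using h(1) unfolding socle_def by simp
  let ?F = "free_n (b (Suc j))"
  interpret F: module R ?F by (rule F_module)
  define g where "g = (\<lambda>i. h \<otimes> unit_vec R (0::nat) i)"
  have u: "unit_vec R 0 \<in> carrier ?F" using rank_pos[of "Suc j"] by (intro unit_vec_carrier) auto
  have g: "g \<in> carrier ?F" using F.smult_closed[OF hR u] unfolding g_def by simp
  have "g i \<in> socle" for i
    using h hR additive_subgroup.zero_closed[OF ideal.axioms(1)[OF socle_ideal]]
    unfolding g_def unit_vec_def by simp
  then have "g \<in> kern (Suc j)"
    using g socle_vec_to_zero[OF g] unfolding kern_simps lin_ker_def by simp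
  then obtain v where v: "v \<in> carrier (free_n (b (Suc (Suc j))))" "f (Suc (Suc j)) v = g"
    unfolding res(4)[of "Suc j", symmetric] by blast
  obtain x y where xy: "x \<in> m" "y \<in> m"
    "\<forall>n::nat. \<forall>r\<in>carrier R. x [^] n \<otimes> r = \<zero> \<longrightarrow> r \<in> socle"
    by (rule parameters_exist[OF dim dim_gt_1])
  have xR: "x \<in> carrier R" using xy(1) by simp
  interpret G: module R "free_n (b (Suc (Suc j)))" by (rule F_module)
  have "f (Suc (Suc j)) (x \<odot>\<^bsub>free_n (b (Suc (Suc j)))\<^esub> v) = x \<odot>\<^bsub>?F\<^esub> g"
    using lin_hom_smult[OF res(3)[of "Suc j"] xR v(1)] v(2) by simp
  also have "\<dots> = (\<lambda>i. \<zero>)"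
    using h xy(1) xR unfolding g_def unit_vec_def socle_def by auto
  finally have "(\<lambda>i. x \<otimes> v i) \<in> kern (Suc (Suc j))"
    using G.smult_closed[OF xR v(1)] unfolding kern_simps lin_ker_def by simp
  from S[OF this] have xv: "x \<otimes> v i \<in> socle" for i .
  have vi: "v i \<in> carrier R" for i using free_module_closed[OF v(1)] .
  have "x [^] (2::nat) \<otimes> v i = \<zero>" for i
  proof -
    have "x [^] (2::nat) \<otimes> v i = x \<otimes> (x \<otimes> v i)"
      using xR vi[of i] by (simp add: numeral_2_eq_2 m_assoc)
    then show ?thesis using xv[of i] xy(1) unfolding socle_def by simp
  qed
  then have "v i \<in> socle" for i using xy(3) vi by blast
  then have "g = (\<lambda>i. \<zero>)" using socle_vec_to_zero[OF v(1)] v(2) by simp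
  then have "g 0 = \<zero>" by simp
  then show False using h hR unfolding g_def unit_vec_def by simp
qed

text \<open>Here \<open>f 1\<close> is a square matrix \<open>A\<close> that is injective modulo the socle and has a cokernel of finite
length. Its determinant would generate an ideal primary to \<open>m\<close>, against Krull's principal ideal
theorem; the weak sequence condition on two parameters gives a direct contradiction instead.\<close>
lemma not_locally_zero_1:
  assumes P: "primeideal P R"
  shows "\<not> locally_zero P 1"
proof
  assume Z: "locally_zero P 1"
  have b10: "b 1 = b 0" using locally_zero_dims[OF P Z] by simp
  define n where "n = b 0"
  define A where "A = f 1"
  have S: "v i \<in> socle" if "v \<in> kern 1" for v i using locally_zero_socle[OF P Z that] .
  interpret F: module R "free_n n" by (rule F_module)
  have A: "A \<in> lin_hom R (free_n n) (free_n n)"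
    using res(3)[of 0] b10 unfolding A_def n_def by simp
  have im: "A ` carrier (free_n n) = kern 0" using res(4)[of 0] b10 unfolding A_def n_def by simp
  have ker: "kern 1 = lin_ker (free_n n) (free_n n) A"
    using kern_simps(2)[of 0] b10 unfolding A_def n_def by simp
  have A_soc: "A v = (\<lambda>i. \<zero>)" if "v \<in> carrier (free_n n)" "\<And>i. v i \<in> socle" for v
    using socle_vec_to_zero[of v 0] that b10 unfolding A_def n_def by simp
  have A_prod: "A v k \<in> J" if "v \<in> carrier (free_n n)" "\<And>i. v i \<in> I" "I \<subseteq> carrier R"
    "ideal J R" "\<And>a p. a \<in> m \<Longrightarrow> p \<in> I \<Longrightarrow> a \<otimes> p \<in> J" for v I J k
    using entries_in_product[of v 0 I J k] that b10 unfolding A_def n_def by simp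
  obtain x y where xy: "x \<in> m" "y \<in> m"
    "\<forall>n::nat. \<forall>r\<in>carrier R. x [^] n \<otimes> r = \<zero> \<longrightarrow> r \<in> socle"
    "\<forall>(n::nat) (k::nat). \<forall>r\<in>carrier R. \<forall>s\<in>carrier R. \<forall>a\<in>m.
       y [^] k \<otimes> r = x [^] n \<otimes> s \<longrightarrow> (\<exists>t\<in>carrier R. a \<otimes> r = x [^] n \<otimes> t)"
    by (rule parameters_exist[OF dim dim_gt_1])
  obtain lx :: nat where lx: "\<forall>v\<in>carrier M. (x [^] Suc lx) \<odot>\<^bsub>M\<^esub> v = \<zero>\<^bsub>M\<^esub>"
    by (rule killed[OF xy(1)])
  obtain ly :: nat where ly: "\<forall>v\<in>carrier M. (y [^] Suc ly) \<odot>\<^bsub>M\<^esub> v = \<zero>\<^bsub>M\<^esub>"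
    by (rule killed[OF xy(2)])
  define X' where "X' = x [^] Suc lx"
  define Y' where "Y' = y [^] Suc ly"
  have xyR: "x \<in> carrier R" "y \<in> carrier R" using xy(1,2) by auto
  have XY: "X' \<in> carrier R" "Y' \<in> carrier R" unfolding X'_def Y'_def using xyR by auto
  have Xm: "X' \<in> m" unfolding X'_def using I_l_closed xy(1) xyR by simp
  have lift: "\<exists>u\<in>carrier (free_n n). A u = z \<odot>\<^bsub>free_n n\<^esub> w"
    if "z \<in> carrier R" "\<And>v. v \<in> carrier M \<Longrightarrow> z \<odot>\<^bsub>M\<^esub> v = \<zero>\<^bsub>M\<^esub>" "w \<in> carrier (free_n n)" for z w
  proof -
    have w: "w \<in> carrier (free_n (b 0))" using that(3) unfolding n_def .
    have "z \<odot>\<^bsub>free_n n\<^esub> w \<in> kern 0"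
      unfolding kern_simps lin_ker_def
      using lin_hom_smult[OF res(1) that(1) w] that(2)[OF lin_hom_closed[OF res(1) w]]
        F.smult_closed[OF that(1,3)] unfolding n_def by simp
    then show ?thesis using im by (metis imageE)
  qed
  \<comment> \<open>Write \<open>X' w = A u\<close> and \<open>Y' w = A v\<close>. Then \<open>Y' u - X' v\<close> lies in the kernel, so it has socle entries,
    which \<open>X' \<in> m\<close> kills; thus \<open>Y' (X' u) = X'\<^sup>2 v\<close>. The colon condition for \<open>X'\<^sup>2\<close> and \<open>Y'\<close> yields
    \<open>a X' u = X'\<^sup>2 t\<close>. Hence \<open>a u - X' t\<close> has socle entries and is killed by \<open>A\<close>, so
    \<open>X' (a w - A t) = 0\<close>.\<close>
  have m_multiple: "\<exists>t\<in>carrier (free_n n). \<exists>h\<in>carrier (free_n n). (\<forall>i. h i \<in> socle) \<and>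
      a \<odot>\<^bsub>free_n n\<^esub> w = A t \<oplus>\<^bsub>free_n n\<^esub> h"
    if a: "a \<in> m" and w: "w \<in> carrier (free_n n)" for a w
  proof -
    have aR: "a \<in> carrier R" using a by simp
    obtain u where u: "u \<in> carrier (free_n n)" "A u = X' \<odot>\<^bsub>free_n n\<^esub> w"
      using lift[OF XY(1) _ w] lx unfolding X'_def by blast
    obtain v where v: "v \<in> carrier (free_n n)" "A v = Y' \<odot>\<^bsub>free_n n\<^esub> w"
      using lift[OF XY(2) _ w] ly unfolding Y'_def by blast
    have c: "u i \<in> carrier R" "v i \<in> carrier R" "w i \<in> carrier R" for i
      using free_module_closed u v w by metis+
    have nX: "\<ominus> X' \<in> carrier R" using XY by simp
    let ?y = "Y' \<odot>\<^bsub>free_n n\<^esub> u \<oplus>\<^bsub>free_n n\<^esub> (\<ominus> X') \<odot>\<^bsub>free_n n\<^esub> v"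
    have "A ?y = Y' \<odot>\<^bsub>free_n n\<^esub> A u \<oplus>\<^bsub>free_n n\<^esub> (\<ominus> X') \<odot>\<^bsub>free_n n\<^esub> A v"
      unfolding lin_hom_add[OF A F.smult_closed[OF XY(2) u(1)] F.smult_closed[OF nX v(1)]]
        lin_hom_smult[OF A XY(2) u(1)] lin_hom_smult[OF A nX v(1)] ..
    also have "\<dots> = \<zero>\<^bsub>free_n n\<^esub>"
    proof
      fix i
      have "Y' \<otimes> (X' \<otimes> w i) \<oplus> (\<ominus> X') \<otimes> (Y' \<otimes> w i) = \<zero>" using c(3)[of i] XY by algebra
      then show "(Y' \<odot>\<^bsub>free_n n\<^esub> A u \<oplus>\<^bsub>free_n n\<^esub> (\<ominus> X') \<odot>\<^bsub>free_n n\<^esub> A v) i = \<zero>\<^bsub>free_n n\<^esub> i"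
        unfolding u(2) v(2) by simp
    qed
    finally have "?y \<in> kern 1"
      unfolding ker lin_ker_def
      using F.M.a_closed[OF F.smult_closed[OF XY(2) u(1)] F.smult_closed[OF nX v(1)]] by blast
    from S[OF this] have yS: "Y' \<otimes> u i \<oplus> (\<ominus> X') \<otimes> v i \<in> socle" for i by simp
    have XX: "X' \<otimes> X' = x [^] (Suc lx + Suc lx)" unfolding X'_def by (rule nat_pow_mult[OF xyR(1)])
    have "\<exists>t\<in>carrier R. a \<otimes> (X' \<otimes> u i) = x [^] (Suc lx + Suc lx) \<otimes> t" for i
    proof (rule xy(4)[rule_format, of _ "v i" a "Suc ly"])
      have "X' \<otimes> (Y' \<otimes> u i \<oplus> (\<ominus> X') \<otimes> v i) = \<zero>" using yS[of i] Xm unfolding socle_def by simp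
      moreover have "Y' \<otimes> (X' \<otimes> u i) = X' \<otimes> (Y' \<otimes> u i \<oplus> (\<ominus> X') \<otimes> v i) \<oplus> (X' \<otimes> X') \<otimes> v i"
        using c[of i] XY by algebra
      ultimately show "y [^] Suc ly \<otimes> (X' \<otimes> u i) = x [^] (Suc lx + Suc lx) \<otimes> v i"
        unfolding XX[symmetric] Y'_def[symmetric] using c[of i] XY by simp
    qed (use c XY a in auto)
    then obtain t0 where t0: "\<And>i. t0 i \<in> carrier R" "\<And>i. a \<otimes> (X' \<otimes> u i) = (X' \<otimes> X') \<otimes> t0 i"
      unfolding XX by metis
    define t where "t = (\<lambda>i. if i < n then t0 i else \<zero>)"
    have t: "t \<in> carrier (free_n n)" unfolding t_def using t0(1) by (auto simp: free_n_carrier)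
    have tR: "t i \<in> carrier R" for i using free_module_closed[OF t] .
    have tX: "a \<otimes> (X' \<otimes> u i) = (X' \<otimes> X') \<otimes> t i" for i
      using t0(2)[of i] u(1) aR XY unfolding t_def by (auto simp: free_n_carrier)
    let ?z = "a \<odot>\<^bsub>free_n n\<^esub> u \<oplus>\<^bsub>free_n n\<^esub> (\<ominus> X') \<odot>\<^bsub>free_n n\<^esub> t"
    have zc: "?z \<in> carrier (free_n n)"
      using F.M.a_closed[OF F.smult_closed[OF aR u(1)] F.smult_closed[OF nX t]] .
    have "?z i \<in> socle" for i
    proof (rule xy(3)[rule_format, of _ "Suc lx"])
      show "?z i \<in> carrier R" using free_module_closed[OF zc] .
      have "X' \<otimes> (a \<otimes> u i \<oplus> (\<ominus> X') \<otimes> t i) = a \<otimes> (X' \<otimes> u i) \<oplus> \<ominus> ((X' \<otimes> X') \<otimes> t i)"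
        using c(1)[of i] tR[of i] XY(1) aR by algebra
      also have "\<dots> = \<zero>" unfolding tX using tR[of i] XY(1) by (simp add: r_neg)
      finally show "x [^] Suc lx \<otimes> ?z i = \<zero>" unfolding X'_def[symmetric] by simp
    qed
    then have "A ?z = (\<lambda>i. \<zero>)" using A_soc[OF zc] by blast
    then have Az: "a \<odot>\<^bsub>free_n n\<^esub> (X' \<odot>\<^bsub>free_n n\<^esub> w) \<oplus>\<^bsub>free_n n\<^esub> (\<ominus> X') \<odot>\<^bsub>free_n n\<^esub> A t = (\<lambda>i. \<zero>)"
      unfolding lin_hom_add[OF A F.smult_closed[OF aR u(1)] F.smult_closed[OF nX t]]
        lin_hom_smult[OF A aR u(1)] lin_hom_smult[OF A nX t] u(2) .
    have AtR: "A t i \<in> carrier R" for i using free_module_closed[OF lin_hom_closed[OF A t]] .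
    define h where "h = (\<lambda>i. a \<otimes> w i \<ominus> A t i)"
    have hc: "h \<in> carrier (free_n n)"
      using w lin_hom_closed[OF A t] aR unfolding h_def by (auto simp: free_n_carrier a_minus_def)
    have "h i \<in> socle" for i
    proof (rule xy(3)[rule_format, of _ "Suc lx"])
      show "h i \<in> carrier R" using free_module_closed[OF hc] .
      have "X' \<otimes> h i = a \<otimes> (X' \<otimes> w i) \<oplus> (\<ominus> X') \<otimes> A t i"
        unfolding h_def using c(3)[of i] AtR[of i] XY(1) aR by algebra
      also have "\<dots> = \<zero>" using fun_cong[OF Az, of i] by simp
      finally show "x [^] Suc lx \<otimes> h i = \<zero>" unfolding X'_def[symmetric] .
    qed
    moreover have "a \<odot>\<^bsub>free_n n\<^esub> w = A t \<oplus>\<^bsub>free_n n\<^esub> h"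
    proof
      fix i
      have "a \<otimes> w i = A t i \<oplus> (a \<otimes> w i \<ominus> A t i)" using c(3)[of i] AtR[of i] aR by algebra
      then show "(a \<odot>\<^bsub>free_n n\<^esub> w) i = (A t \<oplus>\<^bsub>free_n n\<^esub> h) i" unfolding h_def by simp
    qed
    ultimately show ?thesis using t hc by blast
  qed
  \<comment> \<open>For \<open>p \<in> Q\<close> write \<open>p\<close> times a basis vector as \<open>A t + h\<close>. Modulo \<open>Q\<close> the map \<open>A\<close> is injective by
    noetherianity, so \<open>t\<close> has entries in \<open>Q\<close> and \<open>p \<in> m Q + socle\<close>.\<close>
  have prime_is_socle: "Q = socle" if Q: "primeideal Q R" "Q \<noteq> m" for Q
  proof -
    interpret Q: primeideal Q R by (rule Q(1))
    obtain a where a: "a \<in> m" "a \<in> carrier R - Q" by (rule outside_prime[OF Q])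
    have aR: "a \<in> carrier R" using a by simp
    have sub: "socle \<subseteq> Q"
    proof
      fix h assume "h \<in> socle"
      then have "h \<in> carrier R" "a \<otimes> h = \<zero>" using a(1) unfolding socle_def by auto
      then show "h \<in> Q" using Q.I_prime[of a h] a(2) by auto
    qed
    define N where "N = {v \<in> carrier (free_n n). \<forall>i. v i \<in> Q}"
    have N: "submodule N R (free_n n)"
      by (rule F.submoduleI') (auto simp: N_def free_n_carrier Q.I_l_closed)
    have AN: "A v \<in> N" if "v \<in> N" for v
    proof -
      have v: "v \<in> carrier (free_n n)" "\<And>i. v i \<in> Q" using that unfolding N_def by auto
      have "A v k \<in> Q" for k
        by (rule A_prod[OF v _ Q.ideal_axioms]) (auto simp: Q.I_l_closed)
      then show ?thesis unfolding N_def using lin_hom_closed[OF A v(1)] by simp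
    qed
    show ?thesis
    proof (rule noetherian_nakayama[OF Q.ideal_axioms socle_ideal sub])
      fix J assume J: "ideal J R" "socle \<subseteq> J" "\<And>a p. a \<in> m \<Longrightarrow> p \<in> Q \<Longrightarrow> a \<otimes> p \<in> J"
      interpret J: ideal J R by (rule J(1))
      show "Q \<subseteq> J"
      proof
        fix p assume p: "p \<in> Q"
        have pm: "p \<in> m" using prime_le[OF Q(1)] p by blast
        have pR: "p \<in> carrier R" using pm by simp
        have u: "unit_vec R 0 \<in> carrier (free_n n)"
          using rank_pos[of 0] unfolding n_def by (intro unit_vec_carrier) auto
        obtain t h where th: "t \<in> carrier (free_n n)" "h \<in> carrier (free_n n)" "\<And>i. h i \<in> socle"
          "p \<odot>\<^bsub>free_n n\<^esub> unit_vec R 0 = A t \<oplus>\<^bsub>free_n n\<^esub> h"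
          using m_multiple[OF pm u] by blast
        have eq: "p \<otimes> unit_vec R 0 i = A t i \<oplus> h i" for i using fun_cong[OF th(4), of i] by simp
        have AtR: "A t i \<in> carrier R" "h i \<in> carrier R" for i
          using free_module_closed[OF lin_hom_closed[OF A th(1)]] free_module_closed[OF th(2)] by auto
        have "A t i \<in> Q" for i
        proof -
          have "A t i = p \<otimes> unit_vec R 0 i \<oplus> \<ominus> h i" unfolding eq using AtR[of i] by algebra
          also have "\<dots> \<in> Q"
            using sub th(3)[of i] p Q.I_r_closed[OF p] free_module_closed[OF u, of i] by auto
          finally show ?thesis .
        qed
        then have "A t \<in> N" unfolding N_def using lin_hom_closed[OF A th(1)] by simp
        have "\<exists>k::nat. (a [^] k) \<odot>\<^bsub>free_n n\<^esub> t \<in> N"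
        proof (rule F.acc_endo_torsion[OF free_module_acc[OF noetherian_ring_axioms] A N AN aR])
          fix w assume "w \<in> carrier (free_n n)"
          from m_multiple[OF a(1) this] obtain v g where "v \<in> carrier (free_n n)" "g \<in> carrier (free_n n)"
            "\<forall>i. g i \<in> socle" "a \<odot>\<^bsub>free_n n\<^esub> w = A v \<oplus>\<^bsub>free_n n\<^esub> g" by blast
          moreover from this have "g \<in> N" unfolding N_def using sub by blast
          ultimately show "\<exists>v\<in>carrier (free_n n). \<exists>g\<in>N. a \<odot>\<^bsub>free_n n\<^esub> w = A v \<oplus>\<^bsub>free_n n\<^esub> g" by blast
        qed (use th(1) \<open>A t \<in> N\<close> in auto)
        then obtain k :: nat where k: "\<And>i. a [^] k \<otimes> t i \<in> Q" unfolding N_def by auto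
        have tR: "t i \<in> carrier R" for i using free_module_closed[OF th(1)] .
        have tQ: "t i \<in> Q" for i
          using Q.I_prime[OF _ tR k[of i]] primeideal_not_pow[OF Q(1) a(2), of k] by blast
        have "A t 0 \<in> J" by (rule A_prod[OF th(1) tQ _ J(1) J(3)]) auto
        moreover have "p = A t 0 \<oplus> h 0" using eq[of 0] pR unfolding unit_vec_def by simp
        ultimately show "p \<in> J" using J(2) th(3)[of 0] by auto
      qed
    qed
  qed
  have "enat 1 < krull_dim R" using dim dim_gt_1 by simp
  then obtain k p where kp: "k > 1" "\<forall>i\<le>k. p i \<in> Spec R" "\<forall>i<k. p i \<subset> p (Suc i)"
    by (rule krull_dim_greater)
  have pr: "primeideal (p 0) R" "primeideal (p 1) R" "primeideal (p 2) R"
    using kp(1,2) unfolding Spec_def by auto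
  have lt: "p 0 \<subset> p 1" "p 1 \<subset> p 2"
    using kp(3)[rule_format, of 0] kp(3)[rule_format, of 1] kp(1) by (simp_all add: numeral_2_eq_2)
  have "p 1 \<noteq> m" "p 0 \<noteq> m" using lt prime_le[OF pr(3)] by blast+
  then have "p 0 = p 1" using prime_is_socle pr by metis
  then show False using lt by blast
qed

lemma not_locally_zero:
  assumes "primeideal P R"
  shows "\<not> locally_zero P j"
proof -
  consider "j = 0" | "j = 1" | k where "j = Suc (Suc k)" by (metis One_nat_def not0_implies_Suc)
  then show ?thesis
    using not_locally_zero_0 not_locally_zero_1 not_locally_zero_ge_2 assms by cases auto
qed

lemma Syz_module: "module R (Syz R M b e f (Suc j))"
  using submodule.submodule_is_module[OF kern_module F_module, of j] Syz_carrier[of j]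
  unfolding Syz_def by simp

lemma Syz_simps:
  "\<zero>\<^bsub>Syz R M b e f i\<^esub> = (\<lambda>i. \<zero>)" "a \<odot>\<^bsub>Syz R M b e f i\<^esub> v = (\<lambda>i. a \<otimes> v i)"
  unfolding Syz_def by simp_all

text \<open>If the localisation is a single class, then \<open>v / 1 = 0 / 1\<close> for each \<open>v\<close>, so an element outside \<open>P\<close> kills
\<open>v\<close>.\<close>
lemma Syz_Supp: "Supp R (Syz R M b e f (Suc j)) = Spec R"
proof -
  let ?S = "Syz R M b e f (Suc j)"
  have "localization R ?S P \<noteq> {fraction_rel R ?S P `` {(\<zero>\<^bsub>?S\<^esub>, \<one>)}}" if P: "primeideal P R" for P
  proof
    assume L: "localization R ?S P = {fraction_rel R ?S P `` {(\<zero>\<^bsub>?S\<^esub>, \<one>)}}"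
    interpret S: module R ?S by (rule Syz_module)
    have one: "\<one> \<in> carrier R - P" using primeideal_one[OF P] by simp
    have "\<exists>u\<in>carrier R - P. (\<lambda>i. u \<otimes> v i) = (\<lambda>i. \<zero>)" if v: "v \<in> kern j" for v
    proof -
      have vS: "v \<in> carrier ?S" unfolding Syz_carrier using v .
      have "fraction_rel R ?S P `` {(v, \<one>)} \<in> localization R ?S P"
        unfolding localization_def using vS one by (intro quotientI) simp
      then have "fraction_rel R ?S P `` {(v, \<one>)} = fraction_rel R ?S P `` {(\<zero>\<^bsub>?S\<^esub>, \<one>)}"
        unfolding L by simp
      moreover have "(v, \<one>) \<in> fraction_rel R ?S P `` {(v, \<one>)}"
        unfolding fraction_rel_def using vS one by auto
      ultimately have "((\<zero>\<^bsub>?S\<^esub>, \<one>), (v, \<one>)) \<in> fraction_rel R ?S P" by blast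
      then obtain u where u: "u \<in> carrier R - P"
        "u \<odot>\<^bsub>?S\<^esub> (\<one> \<odot>\<^bsub>?S\<^esub> \<zero>\<^bsub>?S\<^esub>) = u \<odot>\<^bsub>?S\<^esub> (\<one> \<odot>\<^bsub>?S\<^esub> v)"
        unfolding fraction_rel_def by blast
      have uR: "u \<in> carrier R" using u(1) by simp
      have "u \<odot>\<^bsub>?S\<^esub> v = \<zero>\<^bsub>?S\<^esub>" using u(2) vS uR S.smult_one S.smult_r_null S.M.zero_closed by metis
      then show ?thesis using u(1) unfolding Syz_simps by blast
    qed
    then show False using not_locally_zero[OF P] unfolding locally_zero_def by blast
  qed
  then show ?thesis unfolding Supp_def Spec_def by blast
qed

lemma Syz_length: "module_length R (Syz R M b e f (Suc j)) = \<infinity>"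
proof (rule ccontr)
  assume "module_length R (Syz R M b e f (Suc j)) \<noteq> \<infinity>"
  then have fin: "module_length R (Syz R M b e f (Suc j)) < \<infinity>" by simp
  have "enat 0 < krull_dim R" using dim dim_gt_1 by simp
  then obtain k p where kp: "k > 0" "\<forall>i\<le>k. p i \<in> Spec R" "\<forall>i<k. p i \<subset> p (Suc i)"
    by (rule krull_dim_greater)
  have pr: "primeideal (p 0) R" "primeideal (p 1) R" and lt: "p 0 \<subset> p 1"
    using kp(1,2) kp(3)[rule_format, of 0] unfolding Spec_def by auto
  have "p 0 \<noteq> m" using lt prime_le[OF pr(2)] by blast
  then obtain x where x: "x \<in> m" "x \<in> carrier R - p 0" by (rule outside_prime[OF pr(1)])
  obtain l :: nat where l: "\<forall>v\<in>carrier (Syz R M b e f (Suc j)). (x [^] l) \<odot>\<^bsub>Syz R M b e f (Suc j)\<^esub> v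
      = \<zero>\<^bsub>Syz R M b e f (Suc j)\<^esub>"
    using finite_length_imp_killed[OF Syz_module fin x(1)] by blast
  have "locally_zero (p 0) j"
    unfolding locally_zero_def
    using l primeideal_not_pow[OF pr(1) x(2), of l] unfolding Syz_carrier Syz_simps by blast
  then show False using not_locally_zero[OF pr(1)] by blast
qed

end

theorem mainTheorem1:
  fixes R :: "('a, 'r) ring_scheme" and m :: "'a set"
    and M :: "('a, 'm, 'c) module_scheme"
    and d :: nat
    and b :: "nat \<Rightarrow> nat"
    and e :: "(nat \<Rightarrow> 'a) \<Rightarrow> 'm"
    and f :: "nat \<Rightarrow> (nat \<Rightarrow> 'a) \<Rightarrow> (nat \<Rightarrow> 'a)"
  assumes "buchsbaum_local_ring R m"
    and "krull_dim R = enat d" and "d > 1"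
    and "module R M" and "finitely_generated_module R M"
    and "carrier M \<noteq> {\<zero>\<^bsub>M\<^esub>}"
    and "proj_dim R M = \<infinity>"
    and "module_length R M < \<infinity>"
    and "minimal_free_resolution R m M b e f"
  shows "(\<forall>i>0. Supp R (Syz R M b e f i) = Spec R) \<and>
         (\<forall>i>0. module_length R (Syz R M b e f i) = \<infinity>)"
proof -
  have "noetherian_local_ring R m" using assms(1) buchsbaum_local_ring.axioms(1) by blast
  then interpret buchsbaum_resolution R m M b e f d
    using assms
    by (intro buchsbaum_resolution.intro buchsbaum_resolution_axioms.intro
        finite_length_resolution.intro finite_length_resolution_axioms.intro)
  have "Supp R (Syz R M b e f i) = Spec R \<and> module_length R (Syz R M b e f i) = \<infinity>" if "i > 0" for i
    using Syz_Supp[of "i - 1"] Syz_length[of "i - 1"] that by simp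
  then show ?thesis by blast
qed

end
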